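(* Let $K$ be a field, $S=K[x_1,\ldots,x_n]$, and let $I=\bigcap_{i=1}^s P_i$ be a reduced (i.e. irredundant) intersection of monomial prime ideals $P_1,\ldots,P_s$ of $S$. Assume that $P_i\not\subset \sum_{1\le j\le s,\ j\neq i} P_j$ for all $i\in\{1,\ldots,s\}$. Then $$\operatorname{depth}_S I=s+\dim S\Big/\sum_{i=1}^s P_i.$$
   Context: A monomial prime ideal of $S=K[x_1,\ldots,x_n]$ is an ideal generated by a subset of the variables. The intersection $\bigcap_{i=1}^s P_i$ is reduced (irredundant) if no $P_i$ can be omitted without changing the intersection, i.e. $P_i\not\subset P_j$ for $i\ne j$. The empty sum of ideals is the zero ideal. $\operatorname{depth}_S$ of a finitely generated graded $S$-module is the depth with respect to the maximal ideal $(x_1,\ldots,x_n)$; $\operatorname{depth}_S I$ is the depth of $I$ as an $S$-module. $\dim$ denotes Krull dimension. *)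

theory Defs
  imports
    "HOL-Library.Poly_Mapping"
    "HOL-Library.Extended_Nat"
    "HOL-Algebra.QuotRing"
    "HOL-Algebra.Module"
begin

section \<open>Polynomial rings in finitely many variables\<close>

text \<open>
  A polynomial is a finitely supported map from exponent vectors to coefficients, with the
  convolution product of \<^theory>\<open>HOL-Library.Poly_Mapping\<close>.  Variables are indexed by natural
  numbers; \<open>mpoly_ring n\<close> consists of the polynomials in the variables with index \<open>1, \<dots>, n\<close> only.
\<close>

type_synonym 'k mpoly = "(nat \<Rightarrow>\<^sub>0 nat) \<Rightarrow>\<^sub>0 'k"

definition mpoly_ring :: "nat \<Rightarrow> ('k::comm_ring_1) mpoly ring" where
  "mpoly_ring n =
     \<lparr>carrier = {p. \<forall>m \<in> Poly_Mapping.keys p. Poly_Mapping.keys m \<subseteq> {1..n}},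
      monoid.mult = (*), one = 1, ring.zero = 0, add = (+)\<rparr>"

definition mvar :: "nat \<Rightarrow> ('k::comm_ring_1) mpoly" where
  "mvar i = Poly_Mapping.single (Poly_Mapping.single i 1) 1"

lemma mvar_closed: "i \<in> {1..n} \<Longrightarrow> mvar i \<in> carrier (mpoly_ring n)"
  by (simp add: mvar_def mpoly_ring_def)

lemma cring_mpoly_ring: "cring (mpoly_ring n :: ('k::comm_ring_1) mpoly ring)"
proof -
  let ?S = "mpoly_ring n :: 'k mpoly ring"
  have add: "p + q \<in> carrier ?S" if "p \<in> carrier ?S" "q \<in> carrier ?S" for p q :: "'k mpoly"
    using that Poly_Mapping.keys_add[of p q] by (fastforce simp: mpoly_ring_def)
  have mult: "p * q \<in> carrier ?S" if "p \<in> carrier ?S" "q \<in> carrier ?S" for p q :: "'k mpoly"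
  proof -
    have "Poly_Mapping.keys m \<subseteq> {1..n}" if m: "m \<in> Poly_Mapping.keys (p * q)" for m
    proof -
      obtain a b where "m = a + b" "a \<in> Poly_Mapping.keys p" "b \<in> Poly_Mapping.keys q"
        using m Poly_Mapping.keys_mult[of p q] by blast
      then show ?thesis
        using \<open>p \<in> carrier ?S\<close> \<open>q \<in> carrier ?S\<close> Poly_Mapping.keys_add[of a b]
        by (fastforce simp: mpoly_ring_def)
    qed
    then show ?thesis by (simp add: mpoly_ring_def)
  qed
  have neg: "\<exists>q \<in> carrier ?S. q + p = 0" if "p \<in> carrier ?S" for p :: "'k mpoly"
    using that by (intro bexI[of _ "- p"]) (simp_all add: mpoly_ring_def)
  have zero_one: "0 \<in> carrier ?S" "1 \<in> carrier ?S"
    by (simp_all add: mpoly_ring_def)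
  have ops: "mult ?S = (*)" "ring.add ?S = (+)" "one ?S = 1" "ring.zero ?S = 0"
    by (simp_all add: mpoly_ring_def)
  show ?thesis
  proof (rule cringI)
    show "abelian_group ?S"
      by (rule abelian_groupI; simp add: ops add neg zero_one add.assoc; simp add: add.commute)
    show "comm_monoid ?S"
      by (rule comm_monoidI; simp add: ops mult zero_one mult.assoc; simp add: mult.commute)
  qed (simp add: ops distrib_right)
qed

definition monomial_prime_ideal :: "nat \<Rightarrow> ('k::field) mpoly set \<Rightarrow> bool" where
  "monomial_prime_ideal n P \<longleftrightarrow> (\<exists>A \<subseteq> {1..n}. P = Idl\<^bsub>mpoly_ring n\<^esub> (mvar ` A))"

definition graded_maximal_ideal :: "nat \<Rightarrow> ('k::field) mpoly set" where
  "graded_maximal_ideal n = Idl\<^bsub>mpoly_ring n\<^esub> (mvar ` {1..n})"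

section \<open>Sums and intersections of families of ideals\<close>

text \<open>The empty sum is the zero ideal; the empty intersection is the whole ring.\<close>

definition ideal_sum :: "('a, 'm) ring_scheme \<Rightarrow> ('i \<Rightarrow> 'a set) \<Rightarrow> 'i set \<Rightarrow> 'a set" where
  "ideal_sum R P J = {finsum R a J | a. a \<in> (\<Pi> j\<in>J. P j)}"

definition ideal_inter :: "('a, 'm) ring_scheme \<Rightarrow> ('i \<Rightarrow> 'a set) \<Rightarrow> 'i set \<Rightarrow> 'a set" where
  "ideal_inter R P J = carrier R \<inter> (\<Inter>j\<in>J. P j)"

definition irredundant :: "('a, 'm) ring_scheme \<Rightarrow> ('i \<Rightarrow> 'a set) \<Rightarrow> 'i set \<Rightarrow> bool" where
  "irredundant R P J \<longleftrightarrow> (\<forall>i\<in>J. ideal_inter R P (J - {i}) \<noteq> ideal_inter R P J)"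

section \<open>Krull dimension\<close>

text \<open>
  The supremum of the lengths of chains of prime ideals.  The zero ring, which has no prime
  ideals, gets the value 0.
\<close>

definition krull_dim :: "('a, 'm) ring_scheme \<Rightarrow> enat" where
  "krull_dim R =
     Sup {enat k | k. \<exists>Q. (\<forall>i\<le>k. primeideal (Q i) R) \<and> (\<forall>i<k. Q i \<subset> Q (Suc i))}"

section \<open>Regular sequences and depth\<close>

text \<open>The submodule \<open>(f\<^sub>1, \<dots>, f\<^sub>r) M\<close> of \<open>M\<close>.\<close>

definition seq_submodule :: "('a, 'b, 'c) module_scheme \<Rightarrow> 'a list \<Rightarrow> 'b set" where
  "seq_submodule M fs =
     {finsum M (\<lambda>j. fs ! j \<odot>\<^bsub>M\<^esub> u j) {..<length fs} | u. u \<in> {..<length fs} \<rightarrow> carrier M}"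

text \<open>
  Each \<open>f\<^sub>i\<close> is a nonzerodivisor on \<open>M / (f\<^sub>1, \<dots>, f\<^sub>i\<^sub>-\<^sub>1) M\<close>, and \<open>M \<noteq> (f\<^sub>1, \<dots>, f\<^sub>r) M\<close>.
\<close>

definition regular_sequence ::
    "('a, 'm) ring_scheme \<Rightarrow> ('a, 'b, 'c) module_scheme \<Rightarrow> 'a list \<Rightarrow> bool" where
  "regular_sequence R M fs \<longleftrightarrow>
     set fs \<subseteq> carrier R \<and>
     (\<forall>i<length fs. \<forall>u\<in>carrier M.
        fs ! i \<odot>\<^bsub>M\<^esub> u \<in> seq_submodule M (take i fs) \<longrightarrow> u \<in> seq_submodule M (take i fs)) \<and>
     seq_submodule M fs \<noteq> carrier M"

text \<open>
  The depth of \<open>M\<close> with respect to an ideal \<open>\<aa>\<close>; by convention the zero module has infinite depth.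
\<close>

definition depth ::
    "('a, 'm) ring_scheme \<Rightarrow> 'a set \<Rightarrow> ('a, 'b, 'c) module_scheme \<Rightarrow> enat" where
  "depth R \<aa> M =
     (if carrier M = {\<zero>\<^bsub>M\<^esub>} then \<infinity>
      else Sup {enat (length fs) | fs. set fs \<subseteq> \<aa> \<and> regular_sequence R M fs})"

text \<open>
  The fields \<open>mult\<close> and \<open>one\<close> of a module record play no role in the module structure.
\<close>

definition ideal_module :: "('a, 'm) ring_scheme \<Rightarrow> 'a set \<Rightarrow> ('a, 'a) module" where
  "ideal_module R I =
     \<lparr>carrier = I, monoid.mult = mult R, one = \<one>\<^bsub>R\<^esub>, ring.zero = \<zero>\<^bsub>R\<^esub>, add = add R,
      smult = mult R\<rparr>"

lemma module_ideal_module: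
  assumes "cring R" "ideal I R"
  shows "module R (ideal_module R I)"
proof -
  interpret cring R by fact
  interpret ideal I R by fact
  have sub: "x \<in> carrier R" if "x \<in> I" for x
    using that a_Hcarr by simp
  show ?thesis
  proof (rule moduleI)
    show "abelian_group (ideal_module R I)"
    proof (rule abelian_groupI)
      show "\<exists>y\<in>carrier (ideal_module R I). y \<oplus>\<^bsub>ideal_module R I\<^esub> x = \<zero>\<^bsub>ideal_module R I\<^esub>"
        if "x \<in> carrier (ideal_module R I)" for x
        using that sub by (intro bexI[of _ "\<ominus>\<^bsub>R\<^esub> x"]) (simp_all add: ideal_module_def l_neg)
    qed (use sub in \<open>simp_all add: ideal_module_def a_ac\<close>)
  qed (use sub in \<open>simp_all add: ideal_module_def l_distr r_distr m_assoc I_l_closed cring_axioms\<close>)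
qed

end

theory Submission
  imports Defs
begin

text \<open>
  Let \<open>P\<^sub>i\<close> be generated by the variables in \<open>A\<^sub>i\<close>.  The hypothesis on the sums says that every \<open>A\<^sub>i\<close>
  contains a private variable \<open>y\<^sub>i\<close>, one that lies in no other \<open>A\<^sub>j\<close>.  Let \<open>d\<close> be the number of variables
  outside the union of the \<open>A\<^sub>i\<close>.  Then both sides of the equation equal \<open>s + d\<close>.

  For the depth, consider the sequence of the private variables \<open>y\<^sub>1, \<dots>, y\<^sub>s\<close> and the \<open>d\<close> free ones.
  It is regular on \<open>I\<close>: since no \<open>A\<^sub>i\<close> contains two of these variables, \<open>I\<close> is even a free module over
  the polynomial ring in them, and a divisibility argument on monomials suffices
  (\<open>weakly_regular_mvars\<close>).  It cannot be extended, because the monomial \<open>y\<^sub>1 \<cdots> y\<^sub>s\<close> is a socle element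
  of the quotient: it is in \<open>I\<close>, not in \<open>(y\<^sub>1, \<dots>, y\<^sub>s, \<dots>) I\<close>, but all its products with variables are
  (\<open>transversal_socle\<close>).

  That no other regular sequence is longer is a special case of the theorem that maximal regular
  sequences have the same length.  It is proved with a complex of Koszul type
  (\<open>weakly_regular_length_le\<close>).  On its cohomology, elements of the maximal ideal act as zero.  A regular
  sequence of length \<open>r\<close> therefore forces the cohomology of \<open>I\<close> to vanish below degree \<open>r\<close>, while a
  regular sequence of length \<open>k\<close> whose quotient has a socle forbids vanishing in all degrees up to \<open>k\<close>.

  The sum of the \<open>P\<^sub>i\<close> is generated by the union of the \<open>A\<^sub>i\<close>, so the other side needs the dimension of
  a polynomial ring in \<open>d\<close> variables (\<open>krull_dim_quotient_monomial_prime\<close>).  Elements picked from the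
  successive differences of a chain of primes are algebraically independent over the field
  (\<open>prime_chain_independent\<close>), but by counting dimensions any \<open>d + 1\<close> polynomials in \<open>d\<close> variables are
  algebraically dependent (\<open>algebraically_dependent\<close>).
\<close>

section \<open>Regular sequences and socles\<close>

text \<open>
  The value at \<open>a\<^sub>1, \<dots>, a\<^sub>i\<close> is the alternating sum of \<open>a\<^sub>j * c (a\<^sub>1, \<dots>, a\<^sub>j\<^sub>-\<^sub>1, a\<^sub>j\<^sub>+\<^sub>1, \<dots>, a\<^sub>i)\<close>, as in the
  Koszul complex.  The cochains are arbitrary functions of a list of ring elements, not alternating
  functions of a list of generators.  This larger complex is easier to handle: the recursion on the
  list carries the signs, and prefixing an element \<open>f\<close> is a homotopy between multiplication by \<open>f\<close>
  and zero, since \<open>f * c as = coboundary (\<lambda>bs. c (f # bs)) as + coboundary c (f # as)\<close>.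
\<close>

primrec coboundary :: "('a::comm_ring_1 list \<Rightarrow> 'a) \<Rightarrow> 'a list \<Rightarrow> 'a" where
  "coboundary c [] = 0"
| "coboundary c (a # as) = a * c as - coboundary (\<lambda>bs. c (a # bs)) as"

lemma coboundary_diff: "coboundary (\<lambda>bs. c bs - c' bs) as = coboundary c as - coboundary c' as"
  by (induction as arbitrary: c c') (simp_all add: algebra_simps)

lemma coboundary_cmult: "coboundary (\<lambda>bs. f * c bs) as = f * coboundary c as"
  by (induction as arbitrary: c) (simp_all add: algebra_simps)

lemma coboundary_coboundary: "coboundary (coboundary c) as = 0"
  by (induction as arbitrary: c) (simp_all add: coboundary_diff coboundary_cmult)

text \<open>
  Only multiplication by elements of \<open>A\<close> enters the complex, so stability under these replaces that
  under a ring of scalars.  Below, \<open>A\<close> is the graded maximal ideal of \<open>mpoly_ring n\<close>.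
\<close>

definition submod :: "'a::comm_ring_1 set \<Rightarrow> 'a set \<Rightarrow> bool" where
  "submod A N \<longleftrightarrow> 0 \<in> N \<and> (\<forall>x\<in>N. \<forall>y\<in>N. x - y \<in> N) \<and> (\<forall>a\<in>A. \<forall>x\<in>N. a * x \<in> N)"

lemma submod_0: "submod A N \<Longrightarrow> 0 \<in> N"
  and submod_diff: "submod A N \<Longrightarrow> x \<in> N \<Longrightarrow> y \<in> N \<Longrightarrow> x - y \<in> N"
  and submod_mult: "submod A N \<Longrightarrow> a \<in> A \<Longrightarrow> x \<in> N \<Longrightarrow> a * x \<in> N"
  by (auto simp: submod_def)

lemma submod_add: "submod A N \<Longrightarrow> x \<in> N \<Longrightarrow> y \<in> N \<Longrightarrow> x + y \<in> N"
  using submod_diff[of A N x "0 - y"] submod_diff[of A N 0 y] submod_0[of A N] by simp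

definition cochains :: "'a set \<Rightarrow> 'a set \<Rightarrow> nat \<Rightarrow> ('a list \<Rightarrow> 'a) set" where
  "cochains A N i = {c. \<forall>as. set as \<subseteq> A \<longrightarrow> length as = i \<longrightarrow> c as \<in> N}"

lemma cochainsD: "c \<in> cochains A N i \<Longrightarrow> set as \<subseteq> A \<Longrightarrow> length as = i \<Longrightarrow> c as \<in> N"
  by (auto simp: cochains_def)

lemma coboundary_cochains:
  assumes "submod A N" "c \<in> cochains A N i"
  shows "coboundary c \<in> cochains A N (Suc i)"
proof -
  have "coboundary c as \<in> N" if "set as \<subseteq> A" "length as = Suc i" for as
    using that assms(2)
  proof (induction as arbitrary: c i)
    case (Cons a as)
    have 1: "a * c as \<in> N"
      using Cons.prems assms(1) by (auto simp: cochains_def intro: submod_mult)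
    have 2: "coboundary (\<lambda>bs. c (a # bs)) as \<in> N"
    proof (cases i)
      case 0
      then show ?thesis using Cons.prems assms(1) by (simp add: submod_0)
    next
      case (Suc j)
      then show ?thesis
        using Cons.prems by (intro Cons.IH[of j]) (auto simp: cochains_def)
    qed
    show ?case using 1 2 assms(1) by (simp add: submod_diff)
  qed simp
  then show ?thesis by (auto simp: cochains_def)
qed

text \<open>
  The cohomology of the complex of cochains on \<open>A\<close> with values in \<open>M / N\<close> vanishes in degree \<open>i\<close>.
  A cochain with values in \<open>M / N\<close> is represented by one with values in \<open>M\<close>.  In degree \<open>0\<close> the
  cochain \<open>e\<close> is unconstrained and harmless, because a coboundary vanishes on the empty list.
\<close>

definition acyclic_at :: "'a::comm_ring_1 set \<Rightarrow> 'a set \<Rightarrow> 'a set \<Rightarrow> nat \<Rightarrow> bool" where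
  "acyclic_at A M N i \<longleftrightarrow>
     (\<forall>c \<in> cochains A M i. coboundary c \<in> cochains A N (Suc i) \<longrightarrow>
        (\<exists>e. (\<forall>j. i = Suc j \<longrightarrow> e \<in> cochains A M j) \<and>
             (\<lambda>as. c as - coboundary e as) \<in> cochains A N i))"

text \<open>
  The coboundary of a cochain with value \<open>t\<close> on the empty list has the value \<open>a * t\<close> on \<open>[a]\<close>, so the
  cohomology in degree \<open>0\<close> is the socle of \<open>M / N\<close>.
\<close>

lemma acyclic_at_0_iff:
  "acyclic_at A M N 0 \<longleftrightarrow> (\<forall>t\<in>M. (\<forall>a\<in>A. a * t \<in> N) \<longrightarrow> t \<in> N)"
proof
  assume L: "acyclic_at A M N 0"
  show "\<forall>t\<in>M. (\<forall>a\<in>A. a * t \<in> N) \<longrightarrow> t \<in> N"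
  proof (intro ballI impI)
    fix t assume t: "t \<in> M" "\<forall>a\<in>A. a * t \<in> N"
    have "(\<lambda>_. t) \<in> cochains A M 0" "coboundary (\<lambda>_. t) \<in> cochains A N (Suc 0)"
      using t by (auto simp: cochains_def length_Suc_conv)
    with L obtain e where "(\<lambda>as. t - coboundary e as) \<in> cochains A N 0"
      unfolding acyclic_at_def by blast
    then show "t \<in> N" by (auto simp: cochains_def)
  qed
next
  assume R: "\<forall>t\<in>M. (\<forall>a\<in>A. a * t \<in> N) \<longrightarrow> t \<in> N"
  show "acyclic_at A M N 0"
    unfolding acyclic_at_def
  proof (intro ballI impI)
    fix c assume c: "c \<in> cochains A M 0" "coboundary c \<in> cochains A N (Suc 0)"
    have "a * c [] \<in> N" if "a \<in> A" for a
      using cochainsD[OF c(2), of "[a]"] that by simp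
    moreover have "c [] \<in> M" using cochainsD[OF c(1), of "[]"] by simp
    ultimately have "c [] \<in> N" using R by blast
    then show "\<exists>e. (\<forall>j. 0 = Suc j \<longrightarrow> e \<in> cochains A M j) \<and>
        (\<lambda>as. c as - coboundary e as) \<in> cochains A N 0"
      by (auto simp: cochains_def)
  qed
qed

definition add_multiples :: "'a::comm_ring_1 set \<Rightarrow> 'a \<Rightarrow> 'a set \<Rightarrow> 'a set" where
  "add_multiples N f M = {x + f * u | x u. x \<in> N \<and> u \<in> M}"

lemma submod_add_multiples:
  assumes "submod A M" "submod A N"
  shows "submod A (add_multiples N f M)"
  unfolding submod_def
proof (intro conjI ballI)
  show "0 \<in> add_multiples N f M"
    using assms by (auto simp: add_multiples_def submod_0 intro!: exI[of _ 0])
next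
  fix x y assume "x \<in> add_multiples N f M" "y \<in> add_multiples N f M"
  then obtain p q u v where "x = p + f * u" "y = q + f * v" "p \<in> N" "q \<in> N" "u \<in> M" "v \<in> M"
    by (auto simp: add_multiples_def)
  moreover from this have "x - y = (p - q) + f * (u - v)" by (simp add: algebra_simps)
  ultimately show "x - y \<in> add_multiples N f M"
    unfolding add_multiples_def using submod_diff[OF assms(1)] submod_diff[OF assms(2)] by blast
next
  fix a x assume "a \<in> A" "x \<in> add_multiples N f M"
  then obtain p u where "x = p + f * u" "p \<in> N" "u \<in> M" by (auto simp: add_multiples_def)
  moreover from this have "a * x = a * p + f * (a * u)" by (simp add: algebra_simps)
  ultimately show "a * x \<in> add_multiples N f M"
    unfolding add_multiples_def using \<open>a \<in> A\<close> submod_mult[OF assms(1)] submod_mult[OF assms(2)]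
    by blast
qed

lemma cochains_add_multiplesE:
  assumes "c \<in> cochains A (add_multiples N f M) i"
  obtains u where "u \<in> cochains A M i" "(\<lambda>as. c as - f * u as) \<in> cochains A N i"
proof -
  have "\<exists>v. v \<in> M \<and> c as - f * v \<in> N" if "set as \<subseteq> A" "length as = i" for as
    using cochainsD[OF assms that] by (auto simp: add_multiples_def)
  then obtain u where "u as \<in> M \<and> c as - f * u as \<in> N" if "set as \<subseteq> A" "length as = i" for as
    by metis
  then show thesis by (intro that[of u]) (auto simp: cochains_def)
qed

lemma cochains_addI:
  "submod A N \<Longrightarrow> c \<in> cochains A N i \<Longrightarrow> c' \<in> cochains A N i \<Longrightarrow> (\<lambda>as. c as + c' as) \<in> cochains A N i"
  by (auto simp: cochains_def intro: submod_add)

lemma cochains_diffI: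
  "submod A N \<Longrightarrow> c \<in> cochains A N i \<Longrightarrow> c' \<in> cochains A N i \<Longrightarrow> (\<lambda>as. c as - c' as) \<in> cochains A N i"
  by (auto simp: cochains_def intro: submod_diff)

text \<open>
  In the long exact sequence of \<open>0 \<rightarrow> M/N \<rightarrow> M/N \<rightarrow> M/(N + f M) \<rightarrow> 0\<close> (multiplication by \<open>f\<close>), vanishing of
  the cohomology of \<open>M/(N + f M)\<close> in degree \<open>i\<close> makes multiplication by \<open>f\<close> injective on the
  cohomology of \<open>M/N\<close> in degree \<open>i + 1\<close>.  But \<open>f \<in> A\<close> acts as zero there, by the prefix homotopy.
\<close>

lemma acyclic_at_lift:
  assumes M: "submod A M" and N: "submod A N" and f: "f \<in> A"
    and nzd: "\<And>u. u \<in> M \<Longrightarrow> f * u \<in> N \<Longrightarrow> u \<in> N"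
    and acyc: "acyclic_at A M (add_multiples N f M) i"
  shows "acyclic_at A M N (Suc i)"
  unfolding acyclic_at_def
proof (intro ballI impI)
  let ?N' = "add_multiples N f M"
  fix c assume c: "c \<in> cochains A M (Suc i)" and dc: "coboundary c \<in> cochains A N (Suc (Suc i))"
  define e where "e = (\<lambda>as. c (f # as))"
  have e: "e \<in> cochains A M i"
    using c f by (auto simp: cochains_def e_def)
  \<comment> \<open>The prefix homotopy: \<open>f\<close> times the cocycle \<open>c\<close> is the coboundary of \<open>e\<close> modulo \<open>N\<close>.\<close>
  have homotopy: "(\<lambda>as. f * c as - coboundary e as) \<in> cochains A N (Suc i)"
  proof -
    have "f * c as - coboundary e as \<in> N" if "set as \<subseteq> A" "length as = Suc i" for as
      using cochainsD[OF dc, of "f # as"] f that by (simp add: e_def)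
    then show ?thesis by (auto simp: cochains_def)
  qed
  \<comment> \<open>So \<open>e\<close> is a cocycle modulo \<open>N + f M\<close>; hence \<open>e = coboundary g + f * u\<close> modulo \<open>N\<close>,
      and applying the coboundary allows \<open>f\<close> to be cancelled.\<close>
  have "coboundary e \<in> cochains A ?N' (Suc i)"
  proof -
    have "coboundary e as \<in> ?N'" if "set as \<subseteq> A" "length as = Suc i" for as
    proof -
      have "0 - (f * c as - coboundary e as) \<in> N"
        using cochainsD[OF homotopy that] submod_0[OF N] submod_diff[OF N] by blast
      moreover have "coboundary e as = (0 - (f * c as - coboundary e as)) + f * c as" by simp
      ultimately show ?thesis using cochainsD[OF c that] unfolding add_multiples_def by blast
    qed
    then show ?thesis by (auto simp: cochains_def)
  qed
  then obtain g where g: "(\<lambda>as. e as - coboundary g as) \<in> cochains A ?N' i"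
    using acyc e unfolding acyclic_at_def by blast
  then obtain u where u: "u \<in> cochains A M i"
    and r: "(\<lambda>as. e as - coboundary g as - f * u as) \<in> cochains A N i"
    by (rule cochains_add_multiplesE)
  have "coboundary (\<lambda>as. e as - coboundary g as - f * u as) \<in> cochains A N (Suc i)"
    using N r by (rule coboundary_cochains)
  also have "coboundary (\<lambda>as. e as - coboundary g as - f * u as) = (\<lambda>as. coboundary e as - f * coboundary u as)"
    by (intro ext) (simp add: coboundary_diff coboundary_cmult coboundary_coboundary)
  finally have "(\<lambda>as. f * c as - coboundary e as + (coboundary e as - f * coboundary u as)) \<in> cochains A N (Suc i)"
    using cochains_addI[OF N homotopy] by blast
  then have "(\<lambda>as. f * (c as - coboundary u as)) \<in> cochains A N (Suc i)"
    by (simp add: algebra_simps)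
  moreover have "(\<lambda>as. c as - coboundary u as) \<in> cochains A M (Suc i)"
    using cochains_diffI[OF M c coboundary_cochains[OF M u]] .
  ultimately have "(\<lambda>as. c as - coboundary u as) \<in> cochains A N (Suc i)"
    using nzd unfolding cochains_def by blast
  then show "\<exists>e. (\<forall>j. Suc i = Suc j \<longrightarrow> e \<in> cochains A M j) \<and>
      (\<lambda>as. c as - coboundary e as) \<in> cochains A N (Suc i)"
    using u by blast
qed

text \<open>
  The exactness of the same sequence at the cohomology of \<open>M/(N + z M)\<close> in degree \<open>i\<close>, which is
  squeezed between that of \<open>M/N\<close> in degrees \<open>i\<close> and \<open>i + 1\<close>.
\<close>

lemma acyclic_at_descend:
  assumes M: "submod A M" and N: "submod A N" and z: "z \<in> A"
    and nzd: "\<And>u. u \<in> M \<Longrightarrow> z * u \<in> N \<Longrightarrow> u \<in> N"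
    and acyc: "acyclic_at A M N i" "acyclic_at A M N (Suc i)"
  shows "acyclic_at A M (add_multiples N z M) i"
  unfolding acyclic_at_def
proof (intro ballI impI)
  let ?N' = "add_multiples N z M"
  fix c assume c: "c \<in> cochains A M i" and dc: "coboundary c \<in> cochains A ?N' (Suc i)"
  from dc obtain b where b: "b \<in> cochains A M (Suc i)"
    and r: "(\<lambda>as. coboundary c as - z * b as) \<in> cochains A N (Suc i)"
    by (rule cochains_add_multiplesE)
  have "coboundary (\<lambda>as. coboundary c as - z * b as) \<in> cochains A N (Suc (Suc i))"
    using N r by (rule coboundary_cochains)
  then have "(\<lambda>as. 0 - coboundary (\<lambda>as. coboundary c as - z * b as) as) \<in> cochains A N (Suc (Suc i))"
    using submod_0[OF N] submod_diff[OF N] unfolding cochains_def by blast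
  then have "(\<lambda>as. z * coboundary b as) \<in> cochains A N (Suc (Suc i))"
    by (simp add: coboundary_diff coboundary_cmult coboundary_coboundary)
  moreover have "coboundary b \<in> cochains A M (Suc (Suc i))"
    using M b by (rule coboundary_cochains)
  ultimately have "coboundary b \<in> cochains A N (Suc (Suc i))"
    using nzd unfolding cochains_def by blast
  with acyc(2) b obtain e where e: "e \<in> cochains A M i"
    and be: "(\<lambda>as. b as - coboundary e as) \<in> cochains A N (Suc i)"
    unfolding acyclic_at_def by blast
  \<comment> \<open>Lifting \<open>c\<close> to a cocycle modulo \<open>N\<close>: its coboundary is \<open>z * b\<close>,
      and \<open>b\<close> is itself the coboundary of \<open>e\<close>.\<close>
  have "(\<lambda>as. coboundary (\<lambda>bs. c bs - z * e bs) as) \<in> cochains A N (Suc i)"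
  proof -
    have "(\<lambda>as. z * (b as - coboundary e as)) \<in> cochains A N (Suc i)"
      using be submod_mult[OF N z] unfolding cochains_def by blast
    from cochains_addI[OF N r this] show ?thesis
      by (simp add: coboundary_diff coboundary_cmult algebra_simps)
  qed
  moreover have "(\<lambda>as. c as - z * e as) \<in> cochains A M i"
    using cochainsD[OF c] cochainsD[OF e] submod_mult[OF M z] submod_diff[OF M]
    unfolding cochains_def by blast
  ultimately obtain g where g: "\<forall>j. i = Suc j \<longrightarrow> g \<in> cochains A M j"
    and ceg: "(\<lambda>as. c as - z * e as - coboundary g as) \<in> cochains A N i"
    using acyc(1) unfolding acyclic_at_def by blast
  have "c as - coboundary g as \<in> ?N'" if "set as \<subseteq> A" "length as = i" for as
  proof -
    have "c as - coboundary g as = (c as - z * e as - coboundary g as) + z * e as" by simp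
    then show ?thesis
      using cochainsD[OF ceg that] cochainsD[OF e that] unfolding add_multiples_def by blast
  qed
  then show "\<exists>e. (\<forall>j. i = Suc j \<longrightarrow> e \<in> cochains A M j) \<and>
      (\<lambda>as. c as - coboundary e as) \<in> cochains A ?N' i"
    using g by (auto simp: cochains_def)
qed

fun multiples :: "'a::comm_ring_1 set \<Rightarrow> 'a list \<Rightarrow> nat \<Rightarrow> 'a set" where
  "multiples M fs 0 = {0}"
| "multiples M fs (Suc i) = add_multiples (multiples M fs i) (fs ! i) M"

definition weakly_regular :: "'a::comm_ring_1 set \<Rightarrow> 'a list \<Rightarrow> bool" where
  "weakly_regular M fs \<longleftrightarrow>
     (\<forall>i<length fs. \<forall>u\<in>M. fs ! i * u \<in> multiples M fs i \<longrightarrow> u \<in> multiples M fs i)"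

lemma submod_multiples: "submod A M \<Longrightarrow> submod A (multiples M fs i)"
  by (induction i) (simp_all add: submod_add_multiples, simp add: submod_def)

lemma acyclic_at_of_weakly_regular:
  assumes "submod A M" "weakly_regular M fs" "set fs \<subseteq> A" "i + j < length fs"
  shows "acyclic_at A M (multiples M fs j) i"
  using assms(4)
proof (induction i arbitrary: j)
  case 0
  then have "fs ! j \<in> A" using assms(3) by (auto dest: nth_mem)
  then show ?case
    using 0 assms(2) by (auto simp: acyclic_at_0_iff weakly_regular_def)
next
  case (Suc i)
  then have "fs ! j \<in> A" using assms(3) by (auto dest: nth_mem)
  moreover have "acyclic_at A M (add_multiples (multiples M fs j) (fs ! j) M) i"
    using Suc.IH[of "Suc j"] Suc.prems by simp
  ultimately show ?case
    using Suc.prems assms(1,2)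
    by (intro acyclic_at_lift[where f = "fs ! j"])
       (auto simp: submod_multiples weakly_regular_def)
qed

lemma acyclic_at_multiples:
  assumes "submod A M" "weakly_regular M zs" "set zs \<subseteq> A"
    and "\<And>i. i \<le> length zs \<Longrightarrow> acyclic_at A M {0} i"
    and "i + j \<le> length zs"
  shows "acyclic_at A M (multiples M zs j) i"
  using assms(5)
proof (induction j arbitrary: i)
  case 0
  then show ?case using assms(4) by simp
next
  case (Suc j)
  then have "zs ! j \<in> A" using assms(3) by (auto dest: nth_mem)
  then show ?case
    unfolding multiples.simps using Suc.prems assms(1,2) Suc.IH[of i] Suc.IH[of "Suc i"]
    by (intro acyclic_at_descend) (auto simp: submod_multiples weakly_regular_def)
qed

text \<open>
  A regular sequence \<open>zs\<close> whose quotient has a socle element \<open>t\<close> is of maximal length.  A longer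
  regular sequence \<open>fs\<close> would make the cohomology of \<open>M\<close> vanish in degrees up to \<open>length zs\<close>;
  dividing by \<open>zs\<close> costs one degree per element, so \<open>M / (zs) M\<close> would still have vanishing
  cohomology in degree \<open>0\<close>, that is, no socle.
\<close>

theorem weakly_regular_length_le:
  assumes M: "submod A M"
    and zs: "weakly_regular M zs" "set zs \<subseteq> A"
    and t: "t \<in> M" "t \<notin> multiples M zs (length zs)"
      "\<And>a. a \<in> A \<Longrightarrow> a * t \<in> multiples M zs (length zs)"
    and fs: "weakly_regular M fs" "set fs \<subseteq> A"
  shows "length fs \<le> length zs"
proof (rule ccontr)
  assume "\<not> length fs \<le> length zs"
  then have "acyclic_at A M {0} i" if "i \<le> length zs" for i
    using acyclic_at_of_weakly_regular[OF M fs, of i 0] that by simp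
  then have "acyclic_at A M (multiples M zs (length zs)) 0"
    using acyclic_at_multiples[OF M zs, of 0 "length zs"] by simp
  then show False using t by (auto simp: acyclic_at_0_iff)
qed

section \<open>Monomial spans and regular sequences of variables\<close>

text \<open>
  Every ideal in the proof is spanned by monomials, so it is described by its set \<open>U\<close> of exponents.
\<close>

definition monomial_span :: "(nat \<Rightarrow>\<^sub>0 nat) set \<Rightarrow> ('k::comm_ring_1) mpoly set" where
  "monomial_span U = {p. Poly_Mapping.keys p \<subseteq> U}"

abbreviation unit_exp :: "nat \<Rightarrow> nat \<Rightarrow>\<^sub>0 nat" where
  "unit_exp i \<equiv> Poly_Mapping.single i 1"

definition exponents :: "nat \<Rightarrow> (nat \<Rightarrow>\<^sub>0 nat) set" where
  "exponents n = {m. Poly_Mapping.keys m \<subseteq> {1..n}}"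

text \<open>
  The exponents of the monomials divisible by some \<open>x\<^sub>i\<close> with \<open>i \<in> A\<close>: they span the ideal
  generated by these variables.
\<close>

definition meeting_exponents :: "nat \<Rightarrow> nat set \<Rightarrow> (nat \<Rightarrow>\<^sub>0 nat) set" where
  "meeting_exponents n A = {m \<in> exponents n. Poly_Mapping.keys m \<inter> A \<noteq> {}}"

lemma mpoly_ring_simps [simp]:
  "carrier (mpoly_ring n) = monomial_span (exponents n)"
  "mult (mpoly_ring n) = (*)" "one (mpoly_ring n) = 1"
  "ring.zero (mpoly_ring n) = 0" "ring.add (mpoly_ring n) = (+)"
  by (auto simp: mpoly_ring_def monomial_span_def exponents_def)

lemma keys_exp_add: "Poly_Mapping.keys (a + b) = Poly_Mapping.keys a \<union> Poly_Mapping.keys b"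
  for a b :: "nat \<Rightarrow>\<^sub>0 nat"
  by (auto simp: in_keys_iff lookup_add)

lemma unit_exp_add_diff:
  "x \<in> Poly_Mapping.keys m \<Longrightarrow> unit_exp x + (m - unit_exp x) = m"
  by (rule poly_mapping_eqI) (auto simp: lookup_add lookup_minus lookup_single when_def in_keys_iff)

lemma add_exponents: "a \<in> exponents n \<Longrightarrow> b \<in> exponents n \<Longrightarrow> a + b \<in> exponents n"
  by (auto simp: exponents_def keys_exp_add)

lemma meeting_exponents_add:
  "a \<in> exponents n \<Longrightarrow> b \<in> meeting_exponents n A \<Longrightarrow> a + b \<in> meeting_exponents n A"
  by (auto simp: meeting_exponents_def exponents_def keys_exp_add)

lemma monomial_span_mono: "U \<subseteq> V \<Longrightarrow> monomial_span U \<subseteq> monomial_span V"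
  by (auto simp: monomial_span_def)

lemma monomial_span_0 [simp]: "0 \<in> monomial_span U"
  by (simp add: monomial_span_def)

lemma monomial_span_add: "p \<in> monomial_span U \<Longrightarrow> q \<in> monomial_span U \<Longrightarrow> p + q \<in> monomial_span U"
  using Poly_Mapping.keys_add[of p q] by (auto simp: monomial_span_def)

lemma keys_uminus_mpoly [simp]: "Poly_Mapping.keys (- p) = Poly_Mapping.keys p"
  for p :: "('k::comm_ring_1) mpoly"
  by (auto simp: in_keys_iff)

lemma monomial_span_uminus: "p \<in> monomial_span U \<Longrightarrow> - p \<in> monomial_span U"
  by (simp add: monomial_span_def)

lemma monomial_span_diff: "p \<in> monomial_span U \<Longrightarrow> q \<in> monomial_span U \<Longrightarrow> p - q \<in> monomial_span U"
  using monomial_span_add[of p U "- q"] by (simp add: monomial_span_uminus)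

lemma monomial_span_sum: "(\<And>i. i \<in> J \<Longrightarrow> f i \<in> monomial_span U) \<Longrightarrow> sum f J \<in> monomial_span U"
  by (induction J rule: infinite_finite_induct) (auto intro: monomial_span_add)

lemma monomial_span_mult:
  assumes "p \<in> monomial_span U" "q \<in> monomial_span V" "\<And>a b. a \<in> U \<Longrightarrow> b \<in> V \<Longrightarrow> a + b \<in> W"
  shows "p * q \<in> monomial_span W"
  using Poly_Mapping.keys_mult[of p q] assms by (fastforce simp: monomial_span_def)

lemma single_monomial_span: "m \<in> U \<Longrightarrow> Poly_Mapping.single m c \<in> monomial_span U"
  by (simp add: monomial_span_def)

lemma mpoly_sum_singles: "(\<Sum>m\<in>Poly_Mapping.keys p. Poly_Mapping.single m (Poly_Mapping.lookup p m)) = p"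
  by (rule poly_mapping_eqI)
     (auto simp: lookup_sum lookup_single when_def in_keys_iff)

text \<open>
  Removing \<open>U\<close> from the exponents of the second summand matters for the quotient by \<open>monomial_span U\<close>,
  where \<open>r\<close> is then the normal form of \<open>p\<close>.
\<close>

lemma monomial_span_Un_split:
  assumes "p \<in> monomial_span (U \<union> V)"
  obtains q r where "p = q + r" "q \<in> monomial_span U" "r \<in> monomial_span (V - U)"
proof
  let ?f = "\<lambda>m. Poly_Mapping.single m (Poly_Mapping.lookup p m)"
  show "p = (\<Sum>m\<in>Poly_Mapping.keys p \<inter> U. ?f m) + (\<Sum>m\<in>Poly_Mapping.keys p - U. ?f m)"
    using sum.Int_Diff[of "Poly_Mapping.keys p" ?f U] by (simp add: mpoly_sum_singles)
  show "(\<Sum>m\<in>Poly_Mapping.keys p \<inter> U. ?f m) \<in> monomial_span U"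
    by (auto intro!: monomial_span_sum single_monomial_span)
  show "(\<Sum>m\<in>Poly_Mapping.keys p - U. ?f m) \<in> monomial_span (V - U)"
    using assms by (intro monomial_span_sum single_monomial_span) (auto simp: monomial_span_def)
qed

lemma lookup_single_mult: "Poly_Mapping.lookup (Poly_Mapping.single a c * p) (a + m) = c * Poly_Mapping.lookup p m"
  for p :: "('k::comm_ring_1) mpoly"
proof -
  have "Poly_Mapping.single a c * p =
      (\<Sum>m\<in>Poly_Mapping.keys p. Poly_Mapping.single (a + m) (c * Poly_Mapping.lookup p m))"
    by (subst mpoly_sum_singles[of p, symmetric], subst sum_distrib_left)
       (simp add: mult_single mpoly_sum_singles)
  then show ?thesis
    by (auto simp: lookup_sum lookup_single when_def in_keys_iff)
qed

lemma keys_single_mult: "Poly_Mapping.keys (Poly_Mapping.single a 1 * p) = (+) a ` Poly_Mapping.keys p"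
  for p :: "('k::comm_ring_1) mpoly"
proof
  show "Poly_Mapping.keys (Poly_Mapping.single a 1 * p) \<subseteq> (+) a ` Poly_Mapping.keys p"
    using Poly_Mapping.keys_mult[of "Poly_Mapping.single a 1" p] by (auto split: if_splits)
  show "(+) a ` Poly_Mapping.keys p \<subseteq> Poly_Mapping.keys (Poly_Mapping.single a 1 * p)"
    by (auto simp: in_keys_iff lookup_single_mult)
qed

lemma monomial_span_shiftE:
  assumes "p \<in> monomial_span ((+) a ` U)"
  obtains q where "p = Poly_Mapping.single a 1 * q" "q \<in> monomial_span U"
proof
  let ?q = "\<Sum>m\<in>Poly_Mapping.keys p. Poly_Mapping.single (m - a) (Poly_Mapping.lookup p m)"
  have sub: "m - a \<in> U \<and> a + (m - a) = m" if "m \<in> Poly_Mapping.keys p" for m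
    using assms that by (auto simp: monomial_span_def)
  show "?q \<in> monomial_span U"
    using sub by (auto intro!: monomial_span_sum single_monomial_span)
  have "Poly_Mapping.single a 1 * ?q = p"
    using sub by (simp add: sum_distrib_left mult_single mpoly_sum_singles)
  then show "p = Poly_Mapping.single a 1 * ?q" by simp
qed

lemma add_multiples_monomial_span:
  "add_multiples (monomial_span W) (mvar j :: ('k::comm_ring_1) mpoly) (monomial_span U) =
   monomial_span (W \<union> (+) (unit_exp j) ` U)"  (is "?L = ?R")
proof
  show "?L \<subseteq> ?R"
  proof
    fix p :: "'k mpoly" assume "p \<in> ?L"
    then obtain x u where p: "p = x + mvar j * u" "x \<in> monomial_span W" "u \<in> monomial_span U"
      by (auto simp: add_multiples_def)
    have "mvar j * u \<in> monomial_span ((+) (unit_exp j) ` U)"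
      using p(3) by (auto simp: mvar_def monomial_span_def keys_single_mult)
    then have "mvar j * u \<in> ?R" "x \<in> ?R"
      using p(2) by (auto simp: monomial_span_def)
    then show "p \<in> ?R"
      unfolding p(1) by (intro monomial_span_add)
  qed
  show "?R \<subseteq> ?L"
  proof
    fix p :: "'k mpoly" assume "p \<in> ?R"
    then obtain q r where p: "p = q + r" "q \<in> monomial_span W"
      and "r \<in> monomial_span ((+) (unit_exp j) ` U - W)"
      by (rule monomial_span_Un_split)
    then have "r \<in> monomial_span ((+) (unit_exp j) ` U)"
      using monomial_span_mono[of "(+) (unit_exp j) ` U - W" "(+) (unit_exp j) ` U"] by auto
    then obtain u where "r = mvar j * u" "u \<in> monomial_span U"
      by (rule monomial_span_shiftE) (auto simp: mvar_def)
    then show "p \<in> ?L" using p by (auto simp: add_multiples_def)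
  qed
qed

text \<open>
  The exponents in \<open>(x\<^sub>j | j \<in> J) M\<close>, where \<open>U\<close> is the set of exponents in the monomial ideal \<open>M\<close>.
\<close>

definition shifted_exponents ::
    "(nat \<Rightarrow>\<^sub>0 nat) set \<Rightarrow> nat set \<Rightarrow> (nat \<Rightarrow>\<^sub>0 nat) set" where
  "shifted_exponents U J = (\<Union>j\<in>J. (+) (unit_exp j) ` U)"

lemma multiples_mvars:
  assumes "i \<le> length js"
  shows "multiples (monomial_span U :: ('k::comm_ring_1) mpoly set) (map mvar js) i =
         monomial_span (shifted_exponents U (set (take i js)))"
  using assms
proof (induction i)
  case 0
  then show ?case by (auto simp: monomial_span_def shifted_exponents_def)
next
  case (Suc i)
  then show ?case
    by (simp add: add_multiples_monomial_span take_Suc_conv_app_nth shifted_exponents_def Un_commute)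
qed

text \<open>
  The exponents in the intersection of the prime ideals \<open>(x\<^sub>j | j \<in> A i)\<close> for \<open>i \<in> T\<close>.
\<close>

definition transversal_exponents :: "nat \<Rightarrow> ('i \<Rightarrow> nat set) \<Rightarrow> 'i set \<Rightarrow> (nat \<Rightarrow>\<^sub>0 nat) set" where
  "transversal_exponents n A T = {m \<in> exponents n. \<forall>i\<in>T. Poly_Mapping.keys m \<inter> A i \<noteq> {}}"

text \<open>
  Let \<open>x\<^sub>l\<close> be a variable of the sequence and \<open>x\<^sub>j\<close> an earlier one.  If \<open>m\<close> and \<open>x\<^sub>l m / x\<^sub>j\<close> are
  monomials in the intersection, then so is \<open>m / x\<^sub>j\<close>: in a set \<open>A i\<close> without \<open>x\<^sub>j\<close> the monomial
  \<open>m / x\<^sub>j\<close> keeps the variable that \<open>m\<close> has there, and a set \<open>A i\<close> with \<open>x\<^sub>j\<close> does not contain \<open>x\<^sub>l\<close>,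
  so \<open>m / x\<^sub>j\<close> keeps the variable that \<open>x\<^sub>l m / x\<^sub>j\<close> has there.
\<close>

lemma weakly_regular_mvars:
  assumes "distinct js"
    and sep: "\<And>i x y. i \<in> T \<Longrightarrow> x \<in> set js \<Longrightarrow> y \<in> set js \<Longrightarrow> x \<in> A i \<Longrightarrow> y \<in> A i \<Longrightarrow> x = y"
  shows "weakly_regular (monomial_span (transversal_exponents n A T) :: ('k::comm_ring_1) mpoly set)
           (map mvar js)"
  unfolding weakly_regular_def
proof (intro allI ballI impI)
  let ?U = "transversal_exponents n A T"
  fix l and u :: "'k mpoly"
  assume l: "l < length (map mvar js :: 'k mpoly list)" and u: "u \<in> monomial_span ?U"
    and zu: "map mvar js ! l * u \<in> multiples (monomial_span ?U) (map mvar js) l"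
  define W where "W = shifted_exponents ?U (set (take l js))"
  have mult: "multiples (monomial_span ?U :: 'k mpoly set) (map mvar js) l = monomial_span W"
    using l by (simp add: multiples_mvars W_def)
  have "m \<in> W" if m: "m \<in> Poly_Mapping.keys u" for m
  proof -
    have mU: "m \<in> ?U" using u m by (auto simp: monomial_span_def)
    have "unit_exp (js ! l) + m \<in> W"
      using zu l m unfolding mult by (auto simp: monomial_span_def mvar_def keys_single_mult)
    then obtain j m' where j: "j \<in> set (take l js)" and m': "m' \<in> ?U"
      and eq: "unit_exp (js ! l) + m = unit_exp j + m'"
      by (auto simp: W_def shifted_exponents_def)
    have jl: "j \<noteq> js ! l"
      using j l assms(1) by (auto simp: in_set_conv_nth nth_eq_iff_index_eq)
    have jm: "j \<in> Poly_Mapping.keys m"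
      using arg_cong[OF eq, of "\<lambda>e. Poly_Mapping.lookup e j"] jl
      by (auto simp: lookup_add lookup_single when_def in_keys_iff)
    define k where "k = m - unit_exp j"
    have mk: "m = unit_exp j + k" using unit_exp_add_diff[OF jm] by (simp add: k_def)
    have m'k: "m' = unit_exp (js ! l) + k"
      using eq unfolding mk by (metis add.left_commute add_left_cancel)
    have "k \<in> ?U"
      unfolding transversal_exponents_def
    proof (safe)
      show "k \<in> exponents n"
        using mU by (simp add: mk transversal_exponents_def exponents_def keys_exp_add)
    next
      fix i assume i: "i \<in> T" and emp: "Poly_Mapping.keys k \<inter> A i = {}"
      have "Poly_Mapping.keys m \<inter> A i \<noteq> {}" "Poly_Mapping.keys m' \<inter> A i \<noteq> {}"
        using mU m' i by (auto simp: transversal_exponents_def)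
      then have "j \<in> A i" "js ! l \<in> A i"
        using emp by (auto simp: mk m'k keys_exp_add split: if_splits)
      then show False
        using sep[OF i, of j "js ! l"] jl j l by (auto dest: in_set_takeD)
    qed
    then show ?thesis using j by (auto simp: W_def shifted_exponents_def mk)
  qed
  then show "u \<in> multiples (monomial_span ?U) (map mvar js) l"
    unfolding mult by (auto simp: monomial_span_def)
qed

lemma transversal_exponents_add:
  "a \<in> exponents n \<Longrightarrow> b \<in> transversal_exponents n A T \<Longrightarrow> a + b \<in> transversal_exponents n A T"
  by (auto simp: transversal_exponents_def exponents_def keys_exp_add)

text \<open>
  The monomial \<open>\<tau>\<close> is the product of the private variables \<open>y i\<close>.  Dividing it by \<open>y i\<close> leaves no
  variable of \<open>A i\<close>, so it is not in \<open>(Z) I\<close>.  A variable \<open>x \<notin> Z\<close> lies in some \<open>A i\<close> and can replace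
  \<open>y i\<close> there, so \<open>x \<tau> = y i (x \<tau> / y i)\<close> is in \<open>(Z) I\<close>.
\<close>

lemma transversal_socle:
  fixes y :: "'i \<Rightarrow> nat"
  assumes "finite T" and A: "\<And>i. i \<in> T \<Longrightarrow> A i \<subseteq> {1..n}"
    and y: "\<And>i. i \<in> T \<Longrightarrow> y i \<in> A i"
    and y': "\<And>i j. i \<in> T \<Longrightarrow> j \<in> T \<Longrightarrow> y i \<in> A j \<Longrightarrow> i = j"
    and Z: "Z = y ` T \<union> ({1..n} - (\<Union>i\<in>T. A i))"
  obtains \<tau> where "\<tau> \<in> transversal_exponents n A T"
    and "\<tau> \<notin> shifted_exponents (transversal_exponents n A T) Z"
    and "\<And>m. m \<in> meeting_exponents n {1..n} \<Longrightarrow>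
           m + \<tau> \<in> shifted_exponents (transversal_exponents n A T) Z"
proof -
  let ?U = "transversal_exponents n A T"
  define \<tau> where "\<tau> = (\<Sum>x\<in>y ` T. unit_exp x)"
  have lk: "Poly_Mapping.lookup \<tau> x = (if x \<in> y ` T then 1 else 0)" for x
    using assms(1) by (auto simp: \<tau>_def lookup_sum lookup_single when_def)
  have keys: "Poly_Mapping.keys \<tau> = y ` T"
    by (auto simp: in_keys_iff lk split: if_splits)
  have \<tau>U: "\<tau> \<in> ?U"
    using A y by (fastforce simp: transversal_exponents_def exponents_def keys)
  have "\<tau> \<notin> shifted_exponents ?U Z"
  proof
    assume "\<tau> \<in> shifted_exponents ?U Z"
    then obtain x m where m: "m \<in> ?U" "\<tau> = unit_exp x + m"
      by (auto simp: shifted_exponents_def)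
    have "x \<in> y ` T" using keys m(2) by (auto simp: keys_exp_add)
    then obtain i where i: "i \<in> T" "x = y i" by blast
    have "Poly_Mapping.lookup m x = 0"
      using lk[of x] i by (simp add: m(2) lookup_add lookup_single)
    then have "x \<notin> Poly_Mapping.keys m" by (simp add: in_keys_iff)
    moreover obtain x' where "x' \<in> Poly_Mapping.keys m" "x' \<in> A i"
      using m(1) i by (auto simp: transversal_exponents_def)
    moreover from this have "x' \<in> y ` T" using keys m(2) by (auto simp: keys_exp_add)
    ultimately show False using y'[OF _ i(1)] i by auto
  qed
  moreover have "m + \<tau> \<in> shifted_exponents ?U Z" if mm: "m \<in> meeting_exponents n {1..n}" for m
  proof -
    obtain x where x: "x \<in> Poly_Mapping.keys m" "x \<in> {1..n}" and m: "m \<in> exponents n"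
      using mm unfolding meeting_exponents_def by blast
    show ?thesis
    proof (cases "x \<in> Z")
      case True
      have "m + \<tau> = unit_exp x + ((m - unit_exp x) + \<tau>)"
        using unit_exp_add_diff[OF x(1)] by (metis add.assoc)
      moreover have "m - unit_exp x \<in> exponents n"
        using m unfolding exponents_def
        by (auto simp: in_keys_iff lookup_minus subset_iff)
      ultimately show ?thesis
        using True transversal_exponents_add[OF _ \<tau>U] unfolding shifted_exponents_def by blast
    next
      case False
      then obtain i where i: "i \<in> T" "x \<in> A i" "x \<noteq> y i" using x Z by auto
      define k where "k = \<tau> - unit_exp (y i)"
      have \<tau>k: "\<tau> = unit_exp (y i) + k"
        using unit_exp_add_diff[of "y i" \<tau>] keys i by (auto simp: k_def)
      have "k + m \<in> ?U"
        unfolding transversal_exponents_def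
      proof safe
        show "k + m \<in> exponents n"
          using \<tau>U m by (simp add: \<tau>k transversal_exponents_def exponents_def keys_exp_add)
      next
        fix j assume j: "j \<in> T" and emp: "Poly_Mapping.keys (k + m) \<inter> A j = {}"
        then have "j \<noteq> i" using i x by (auto simp: keys_exp_add)
        then have "y j \<noteq> y i" using y'[OF i(1) j] y[OF j] by auto
        then have "Poly_Mapping.lookup k (y j) = 1"
          using lk[of "y j"] j by (simp add: \<tau>k lookup_add lookup_single when_def)
        then have "y j \<in> Poly_Mapping.keys k" by (simp add: in_keys_iff)
        then show False using emp y[OF j] by (auto simp: keys_exp_add)
      qed
      moreover have "m + \<tau> = unit_exp (y i) + (k + m)" by (simp add: \<tau>k ac_simps)
      ultimately show ?thesis using i Z unfolding shifted_exponents_def by blast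
    qed
  qed
  ultimately show thesis using \<tau>U that by blast
qed

section \<open>Ideals of the polynomial ring and the depth of an intersection\<close>

lemma finsum_eq_sum:
  fixes f :: "'i \<Rightarrow> 'a::comm_monoid_add"
  assumes "abelian_monoid G" "ring.add G = (+)" "ring.zero G = 0" "f ` J \<subseteq> carrier G"
  shows "finsum G f J = sum f J"
proof -
  interpret abelian_monoid G by fact
  show ?thesis
    using assms(4)
  proof (induction J rule: infinite_finite_induct)
    case (infinite J)
    then show ?case by (simp add: finsum_infinite assms)
  next
    case (insert x J)
    then have "finsum G f (insert x J) = f x \<oplus>\<^bsub>G\<^esub> finsum G f J"
      by (intro finsum_insert) auto
    then show ?case using insert by (simp add: assms)
  qed (simp add: assms)
qed

lemma seq_submodule_ideal_module:
  fixes fs :: "'k::comm_ring_1 mpoly list"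
  assumes I: "ideal I (mpoly_ring n)" and fs: "set fs \<subseteq> carrier (mpoly_ring n)"
    and i: "i \<le> length fs"
  shows "seq_submodule (ideal_module (mpoly_ring n) I) (take i fs) = multiples I fs i"
proof -
  interpret ideal I "mpoly_ring n" by fact
  let ?M = "ideal_module (mpoly_ring n) I"
  have M: "abelian_monoid ?M"
    using module_ideal_module[OF cring_mpoly_ring I]
    by (simp add: module_def abelian_group_def)
  have "seq_submodule ?M (take i fs) = {\<Sum>j<i. fs ! j * u j | u. u \<in> {..<i} \<rightarrow> I}"
  proof -
    have "finsum ?M (\<lambda>j. take i fs ! j \<odot>\<^bsub>?M\<^esub> u j) {..<i} = (\<Sum>j<i. fs ! j * u j)"
      if u: "u \<in> {..<i} \<rightarrow> I" for u
    proof -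
      have "fs ! j \<in> carrier (mpoly_ring n)" if "j < i" for j
        using fs i that nth_mem[of j fs] by auto
      then have "fs ! j * u j \<in> I" if "j < i" for j
        using that u I_l_closed[of "u j" "fs ! j"] by auto
      then have "(\<lambda>j. take i fs ! j \<odot>\<^bsub>?M\<^esub> u j) ` {..<i} \<subseteq> carrier ?M"
        by (auto simp: ideal_module_def)
      then have "finsum ?M (\<lambda>j. take i fs ! j \<odot>\<^bsub>?M\<^esub> u j) {..<i} =
          (\<Sum>j<i. take i fs ! j \<odot>\<^bsub>?M\<^esub> u j)"
        by (intro finsum_eq_sum M) (auto simp: ideal_module_def)
      then show ?thesis by (simp add: ideal_module_def)
    qed
    then have "(\<lambda>u. finsum ?M (\<lambda>j. take i fs ! j \<odot>\<^bsub>?M\<^esub> u j) {..<i}) ` ({..<i} \<rightarrow> I) =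
        (\<lambda>u. \<Sum>j<i. fs ! j * u j) ` ({..<i} \<rightarrow> I)"
      by (intro image_cong refl)
    moreover have "length (take i fs) = i" "carrier ?M = I"
      using i by (simp_all add: ideal_module_def)
    ultimately show ?thesis unfolding seq_submodule_def by (simp add: Setcompr_eq_image)
  qed
  also have "\<dots> = multiples I fs i"
  proof (induction i)
    case (Suc i)
    have "{\<Sum>j<Suc i. fs ! j * u j | u. u \<in> {..<Suc i} \<rightarrow> I} =
        add_multiples {\<Sum>j<i. fs ! j * u j | u. u \<in> {..<i} \<rightarrow> I} (fs ! i) I" (is "?L = ?R")
    proof
      show "?L \<subseteq> ?R"
      proof
        fix p assume "p \<in> ?L"
        then obtain u where u: "u \<in> {..<Suc i} \<rightarrow> I" and p: "p = (\<Sum>j<Suc i. fs ! j * u j)"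
          by blast
        have "p = (\<Sum>j<i. fs ! j * u j) + fs ! i * u i" using p by simp
        moreover have "u \<in> {..<i} \<rightarrow> I" "u i \<in> I" using u by auto
        ultimately show "p \<in> ?R" unfolding add_multiples_def by blast
      qed
      show "?R \<subseteq> ?L"
      proof
        fix p assume "p \<in> ?R"
        then obtain u v where u: "u \<in> {..<i} \<rightarrow> I" and v: "v \<in> I"
          and p: "p = (\<Sum>j<i. fs ! j * u j) + fs ! i * v"
          by (auto simp: add_multiples_def)
        have "p = (\<Sum>j<Suc i. fs ! j * (u(i := v)) j)" using p by simp
        moreover have "u(i := v) \<in> {..<Suc i} \<rightarrow> I" using u v by (auto simp: Pi_def less_Suc_eq)
        ultimately show "p \<in> ?L" by blast
      qed
    qed
    then show ?case using Suc by simp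
  qed simp
  finally show ?thesis .
qed

lemma regular_sequence_ideal_module_iff:
  fixes fs :: "'k::comm_ring_1 mpoly list"
  assumes "ideal I (mpoly_ring n)" "set fs \<subseteq> carrier (mpoly_ring n)"
  shows "regular_sequence (mpoly_ring n) (ideal_module (mpoly_ring n) I) fs \<longleftrightarrow>
           weakly_regular I fs \<and> multiples I fs (length fs) \<noteq> I"
  using seq_submodule_ideal_module[OF assms] seq_submodule_ideal_module[OF assms, of "length fs"] assms(2)
  by (auto simp: regular_sequence_def weakly_regular_def ideal_module_def)

lemma ideal_monomial_span:
  fixes U :: "(nat \<Rightarrow>\<^sub>0 nat) set"
  assumes "U \<subseteq> exponents n" and up: "\<And>a b. a \<in> exponents n \<Longrightarrow> b \<in> U \<Longrightarrow> a + b \<in> U"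
  shows "ideal (monomial_span U :: ('k::comm_ring_1) mpoly set) (mpoly_ring n)"
proof (rule idealI)
  interpret cring "mpoly_ring n :: 'k mpoly ring" by (rule cring_mpoly_ring)
  show "ring (mpoly_ring n :: 'k mpoly ring)" by (rule ring_axioms)
  have inv: "\<ominus>\<^bsub>mpoly_ring n\<^esub> p = - p" if "p \<in> carrier (mpoly_ring n)" for p :: "'k mpoly"
    using that by (intro minus_equality) (simp_all add: monomial_span_uminus)
  show "subgroup (monomial_span U) (add_monoid (mpoly_ring n :: 'k mpoly ring))"
  proof (rule add.subgroupI)
    show "(monomial_span U :: 'k mpoly set) \<subseteq> carrier (mpoly_ring n)"
      using assms(1) by (simp add: monomial_span_mono)
    then show "\<ominus>\<^bsub>mpoly_ring n\<^esub> p \<in> monomial_span U" if "p \<in> monomial_span U" for p :: "'k mpoly"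
      using that inv[of p] by (auto simp: monomial_span_uminus)
    show "(monomial_span U :: 'k mpoly set) \<noteq> {}" using monomial_span_0 by blast
  qed (simp add: monomial_span_add)
  show "x \<otimes>\<^bsub>mpoly_ring n\<^esub> a \<in> monomial_span U" "a \<otimes>\<^bsub>mpoly_ring n\<^esub> x \<in> monomial_span U"
    if "a \<in> monomial_span U" "x \<in> carrier (mpoly_ring n)" for a x :: "'k mpoly"
  proof -
    have "x * a \<in> monomial_span U"
      using that by (intro monomial_span_mult[of x "exponents n" a U]) (auto intro: up)
    then show "x \<otimes>\<^bsub>mpoly_ring n\<^esub> a \<in> monomial_span U" "a \<otimes>\<^bsub>mpoly_ring n\<^esub> x \<in> monomial_span U"
      by (simp_all add: mult.commute)
  qed
qed

lemma exponents_mono_diff: "m \<in> exponents n \<Longrightarrow> m - k \<in> exponents n"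
  unfolding exponents_def by (auto simp: in_keys_iff lookup_minus subset_iff)

lemma ideal_meeting: "ideal (monomial_span (meeting_exponents n A) :: ('k::comm_ring_1) mpoly set) (mpoly_ring n)"
  by (rule ideal_monomial_span)
     (auto simp: meeting_exponents_add, auto simp: meeting_exponents_def)

lemma genideal_mvars:
  assumes "A \<subseteq> {1..n}"
  shows "Idl\<^bsub>mpoly_ring n\<^esub> (mvar ` A :: ('k::comm_ring_1) mpoly set) =
         monomial_span (meeting_exponents n A)" (is "_ = ?P")
proof
  interpret cring "mpoly_ring n :: 'k mpoly ring" by (rule cring_mpoly_ring)
  have mvars: "mvar ` A \<subseteq> carrier (mpoly_ring n :: 'k mpoly ring)"
    using assms mvar_closed[of _ n] by blast
  show "Idl\<^bsub>mpoly_ring n\<^esub> (mvar ` A) \<subseteq> ?P"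
  proof (rule genideal_minimal)
    show "mvar ` A \<subseteq> ?P"
      using assms by (auto simp: mvar_def monomial_span_def meeting_exponents_def exponents_def)
  qed (rule ideal_meeting)
  show "?P \<subseteq> Idl\<^bsub>mpoly_ring n\<^esub> (mvar ` A)"
  proof
    interpret J: ideal "Idl\<^bsub>mpoly_ring n\<^esub> (mvar ` A :: 'k mpoly set)" "mpoly_ring n"
      using mvars by (rule genideal_ideal)
    let ?J = "Idl\<^bsub>mpoly_ring n\<^esub> (mvar ` A :: 'k mpoly set)"
    fix p :: "'k mpoly" assume p: "p \<in> ?P"
    have "Poly_Mapping.single m (Poly_Mapping.lookup p m) \<in> ?J" if "m \<in> Poly_Mapping.keys p" for m
    proof -
      have "m \<in> meeting_exponents n A" using p that by (auto simp: monomial_span_def)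
      then obtain x where x: "x \<in> Poly_Mapping.keys m" "x \<in> A" and m: "m \<in> exponents n"
        by (auto simp: meeting_exponents_def)
      have "mvar x \<in> ?J" using genideal_self[OF mvars] x by blast
      moreover have "Poly_Mapping.single (m - unit_exp x) (Poly_Mapping.lookup p m)
          \<in> carrier (mpoly_ring n)"
        using m by (auto intro!: single_monomial_span exponents_mono_diff)
      ultimately have "mvar x \<otimes>\<^bsub>mpoly_ring n\<^esub>
          Poly_Mapping.single (m - unit_exp x) (Poly_Mapping.lookup p m) \<in> ?J"
        by (rule J.I_r_closed)
      then show ?thesis
        using unit_exp_add_diff[OF x(1)] by (simp add: mvar_def mult_single)
    qed
    then have "\<forall>m\<in>Poly_Mapping.keys p. Poly_Mapping.single m (Poly_Mapping.lookup p m) \<in> ?J"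
      by (rule ballI)
    moreover have sum: "sum f K \<in> ?J" if all: "\<forall>m\<in>K. f m \<in> ?J" for f :: "(nat \<Rightarrow>\<^sub>0 nat) \<Rightarrow> 'k mpoly" and K
      using all
    proof (induction K rule: infinite_finite_induct)
      case (insert m K)
      then show ?case using J.a_closed[of "f m" "sum f K"] by simp
    qed (use J.zero_closed in simp_all)
    ultimately have "(\<Sum>m\<in>Poly_Mapping.keys p. Poly_Mapping.single m (Poly_Mapping.lookup p m)) \<in> ?J"
      by (intro sum)
    then show "p \<in> ?J" by (simp only: mpoly_sum_singles)
  qed
qed

lemma ideal_sum_monomial_primes:
  assumes "finite J" "\<And>j. j \<in> J \<Longrightarrow> P j = monomial_span (meeting_exponents n (A j))"
  shows "ideal_sum (mpoly_ring n) P J =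
         (monomial_span (meeting_exponents n (\<Union>j\<in>J. A j)) :: ('k::comm_ring_1) mpoly set)"
    (is "?L = ?R")
proof -
  interpret cring "mpoly_ring n :: 'k mpoly ring" by (rule cring_mpoly_ring)
  have sub: "P j \<subseteq> carrier (mpoly_ring n)" if "j \<in> J" for j
    using assms(2)[OF that] by (simp add: monomial_span_mono meeting_exponents_def)
  have "?L = {sum a J | a. a \<in> (\<Pi> j\<in>J. P j)}"
  proof -
    have "finsum (mpoly_ring n) a J = sum a J" if "a \<in> (\<Pi> j\<in>J. P j)" for a
      using that sub by (intro finsum_eq_sum) (auto simp: abelian_monoid_axioms)
    then show ?thesis unfolding ideal_sum_def by metis
  qed
  also have "\<dots> = ?R"
    using assms
  proof (induction J rule: finite_induct)
    case empty
    then show ?case by (auto simp: monomial_span_def meeting_exponents_def)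
  next
    case (insert i J)
    let ?V = "meeting_exponents n (\<Union>j\<in>J. A j)"
    have IH: "{sum a J | a. a \<in> (\<Pi> j\<in>J. P j)} = monomial_span ?V"
      using insert by auto
    have Un: "meeting_exponents n (\<Union>j\<in>insert i J. A j) = meeting_exponents n (A i) \<union> ?V"
      by (auto simp: meeting_exponents_def)
    show ?case
      unfolding Un
    proof safe
      fix a assume a: "a \<in> (\<Pi> j\<in>insert i J. P j)"
      then have "sum a J \<in> monomial_span ?V" using IH by auto
      moreover have "a i \<in> monomial_span (meeting_exponents n (A i))" using a insert by auto
      ultimately show "sum a (insert i J) \<in> monomial_span (meeting_exponents n (A i) \<union> ?V)"
        using insert(1,2) Poly_Mapping.keys_add[of "a i" "sum a J"]
        by (auto simp: monomial_span_def)
    next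
      fix p :: "'k mpoly" assume "p \<in> monomial_span (meeting_exponents n (A i) \<union> ?V)"
      then obtain q r where p: "p = q + r" and q: "q \<in> monomial_span (meeting_exponents n (A i))"
        and "r \<in> monomial_span (?V - meeting_exponents n (A i))"
        by (rule monomial_span_Un_split)
      then have "r \<in> monomial_span ?V" by (auto simp: monomial_span_def)
      then obtain a where a: "a \<in> (\<Pi> j\<in>J. P j)" "r = sum a J" using IH by blast
      have "p = sum (a(i := q)) (insert i J)"
        using insert(1,2) sum.cong[of J J "a(i := q)" a] by (fastforce simp: p a(2))
      moreover have "a(i := q) \<in> (\<Pi> j\<in>insert i J. P j)" using a(1) q insert by auto
      ultimately show "\<exists>a. p = sum a (insert i J) \<and> a \<in> (\<Pi> j\<in>insert i J. P j)" by blast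
    qed
  qed
  finally show ?thesis .
qed

text \<open>
  The maximal regular sequence consists of one private variable \<open>y i \<in> A i\<close> for each \<open>i \<in> T\<close> and of
  the variables that lie in no \<open>A i\<close> at all.
\<close>

lemma depth_intersection_monomial_primes:
  fixes T :: "'i set" and A :: "'i \<Rightarrow> nat set"
  assumes T: "finite T" and A: "\<And>i. i \<in> T \<Longrightarrow> A i \<subseteq> {1..n}"
    and priv: "\<And>i. i \<in> T \<Longrightarrow> \<not> A i \<subseteq> (\<Union>j\<in>T - {i}. A j)"
  shows "depth (mpoly_ring n) (graded_maximal_ideal n)
           (ideal_module (mpoly_ring n) (monomial_span (transversal_exponents n A T) :: ('k::field) mpoly set))
         = enat (card T + (n - card (\<Union>i\<in>T. A i)))"
proof -
  let ?S = "mpoly_ring n :: 'k mpoly ring"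
  let ?U = "transversal_exponents n A T"
  let ?I = "monomial_span ?U :: 'k mpoly set"
  let ?m = "graded_maximal_ideal n :: 'k mpoly set"
  have I: "ideal ?I ?S"
    by (rule ideal_monomial_span)
       (auto simp: transversal_exponents_add, auto simp: transversal_exponents_def)
  have m: "?m = monomial_span (meeting_exponents n {1..n})"
    unfolding graded_maximal_ideal_def by (rule genideal_mvars) simp
  have m_carrier: "?m \<subseteq> carrier ?S"
    by (simp add: m monomial_span_mono meeting_exponents_def)
  have subm: "submod ?m ?I"
  proof -
    have "a * x \<in> ?I" if "a \<in> ?m" "x \<in> ?I" for a x
      using that unfolding m
      by (rule monomial_span_mult) (auto intro: transversal_exponents_add simp: meeting_exponents_def)
    then show ?thesis by (auto simp: submod_def monomial_span_diff)
  qed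
  have "\<forall>i\<in>T. \<exists>x. x \<in> A i \<and> (\<forall>j\<in>T. x \<in> A j \<longrightarrow> i = j)"
    using priv by blast
  then obtain y where y: "\<And>i. i \<in> T \<Longrightarrow> y i \<in> A i"
    and y': "\<And>i j. i \<in> T \<Longrightarrow> j \<in> T \<Longrightarrow> y i \<in> A j \<Longrightarrow> i = j"
    by metis
  define F where "F = {1..n} - (\<Union>i\<in>T. A i)"
  define js where "js = sorted_list_of_set (y ` T \<union> F)"
  have set_js: "set js = y ` T \<union> F" and "distinct js"
    using T by (simp_all add: js_def F_def)
  have length_js: "length js = card T + (n - card (\<Union>i\<in>T. A i))"
  proof -
    have "inj_on y T" using y y' by (metis inj_onI)
    moreover have "y ` T \<inter> F = {}" using y by (auto simp: F_def)
    moreover have "card F = n - card (\<Union>i\<in>T. A i)"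
    proof -
      have "(\<Union>i\<in>T. A i) \<subseteq> {1..n}" using A by blast
      then show ?thesis
        unfolding F_def by (simp add: card_Diff_subset finite_subset[OF _ finite_atLeastAtMost])
    qed
    ultimately show ?thesis
      using T by (simp add: js_def card_Un_disjoint card_image F_def)
  qed
  define zs where "zs = (map mvar js :: 'k mpoly list)"
  have zs_m: "set zs \<subseteq> ?m"
    using set_js y A
    by (fastforce simp: zs_def m mvar_def monomial_span_def meeting_exponents_def exponents_def F_def)
  have js_A: "x = y i" if "i \<in> T" "x \<in> set js" "x \<in> A i" for x i
    using that y' unfolding set_js F_def by blast
  have zs_reg: "weakly_regular ?I zs"
    unfolding zs_def by (rule weakly_regular_mvars[OF \<open>distinct js\<close>]) (metis js_A)
  have zs_mult: "multiples ?I zs (length zs) = monomial_span (shifted_exponents ?U (y ` T \<union> F))"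
    using multiples_mvars[of "length js" js ?U] by (simp add: zs_def set_js)
  obtain \<tau> where \<tau>: "\<tau> \<in> ?U" "\<tau> \<notin> shifted_exponents ?U (y ` T \<union> F)"
    "\<And>m. m \<in> meeting_exponents n {1..n} \<Longrightarrow> m + \<tau> \<in> shifted_exponents ?U (y ` T \<union> F)"
    using transversal_socle[OF T A y y' arg_cong2[of _ _ _ _ "(\<union>)", OF refl F_def]] by blast
  define t where "t = (Poly_Mapping.single \<tau> 1 :: 'k mpoly)"
  have t: "t \<in> ?I" "t \<notin> multiples ?I zs (length zs)"
    using \<tau> unfolding t_def zs_mult by (auto simp: monomial_span_def)
  have t_socle: "a * t \<in> multiples ?I zs (length zs)" if "a \<in> ?m" for a
    using that unfolding m zs_mult t_def
    by (rule monomial_span_mult[where V = "{\<tau>}"]) (use \<tau>(3) in \<open>auto simp: monomial_span_def\<close>)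
  let ?L = "{enat (length fs) | fs. set fs \<subseteq> ?m \<and> regular_sequence ?S (ideal_module ?S ?I) fs}"
  have reg_iff: "regular_sequence ?S (ideal_module ?S ?I) fs \<longleftrightarrow>
      weakly_regular ?I fs \<and> multiples ?I fs (length fs) \<noteq> ?I" if "set fs \<subseteq> ?m" for fs
    using that m_carrier by (intro regular_sequence_ideal_module_iff I) blast
  have "Sup ?L = enat (length zs)"
  proof (rule antisym)
    show "Sup ?L \<le> enat (length zs)"
    proof (rule Sup_least)
      fix e assume "e \<in> ?L"
      then obtain fs where "e = enat (length fs)" "set fs \<subseteq> ?m" "weakly_regular ?I fs"
        using reg_iff by auto
      then show "e \<le> enat (length zs)"
        using weakly_regular_length_le[OF subm zs_reg zs_m t t_socle] by simp
    qed
    show "enat (length zs) \<le> Sup ?L"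
      using reg_iff[OF zs_m] zs_reg zs_m t by (intro Sup_upper) blast
  qed
  moreover have "carrier (ideal_module ?S ?I) \<noteq> {\<zero>\<^bsub>ideal_module ?S ?I\<^esub>}"
  proof -
    have "t \<noteq> 0" using t(2) monomial_span_0 unfolding zs_mult by metis
    then show ?thesis using t(1) by (auto simp: ideal_module_def)
  qed
  ultimately show ?thesis
    by (simp add: depth_def length_js zs_def)
qed

section \<open>Algebraic dependence\<close>

text \<open>
  Fewer equations than unknowns, by Gaussian elimination.
\<close>

lemma homogeneous_system_nontrivial:
  fixes v :: "'a \<Rightarrow> 'b \<Rightarrow> 'k::field"
  assumes "finite E" "finite X" "card E < card X"
  obtains c where "\<exists>x\<in>X. c x \<noteq> 0" "\<And>e. e \<in> E \<Longrightarrow> (\<Sum>x\<in>X. c x * v x e) = 0"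
proof -
  have "\<exists>c. (\<exists>x\<in>X. c x \<noteq> 0) \<and> (\<forall>e\<in>E. (\<Sum>x\<in>X. c x * v x e) = 0)"
    using assms
  proof (induction E arbitrary: X v rule: finite_induct)
    case empty
    then obtain x where "x \<in> X" by fastforce
    then show ?case by (intro exI[of _ "\<lambda>_. 1"]) auto
  next
    case (insert e E)
    show ?case
    proof (cases "\<exists>x\<in>X. v x e \<noteq> 0")
      case False
      moreover have "card E < card X" using insert by simp
      ultimately show ?thesis using insert.IH[OF insert.prems(1), of v] by auto
    next
      case True
      then obtain x0 where x0: "x0 \<in> X" "v x0 e \<noteq> 0" by blast
      define X' where "X' = X - {x0}"
      \<comment> \<open>Eliminating the unknown \<open>x0\<close> with the equation \<open>e\<close>.\<close>
      define w where "w = (\<lambda>x e'. v x e' - v x e / v x0 e * v x0 e')"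
      have X': "finite X'" "card E < card X'" "X = insert x0 X'" "x0 \<notin> X'"
        using insert x0 by (auto simp: X'_def)
      obtain c where c: "\<exists>x\<in>X'. c x \<noteq> 0" "\<forall>e'\<in>E. (\<Sum>x\<in>X'. c x * w x e') = 0"
        using insert.IH[OF X'(1,2), of w] by blast
      define c0 where "c0 = - (\<Sum>x\<in>X'. c x * (v x e / v x0 e))"
      define c' where "c' = c(x0 := c0)"
      have sum: "(\<Sum>x\<in>X. c' x * v x e') = (\<Sum>x\<in>X'. c x * w x e')" for e'
      proof -
        have "(\<Sum>x\<in>X. c' x * v x e') = c0 * v x0 e' + (\<Sum>x\<in>X'. c' x * v x e')"
          using X' by (simp add: c'_def)
        also have "(\<Sum>x\<in>X'. c' x * v x e') = (\<Sum>x\<in>X'. c x * v x e')"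
          using X'(4) by (intro sum.cong) (auto simp: c'_def)
        also have "c0 * v x0 e' = - (\<Sum>x\<in>X'. c x * (v x e / v x0 e * v x0 e'))"
          by (simp add: c0_def sum_distrib_right mult.assoc)
        finally show ?thesis by (simp add: w_def algebra_simps sum_subtractf)
      qed
      have "w x e = 0" for x using x0 by (simp add: w_def)
      then have "\<forall>e'\<in>insert e E. (\<Sum>x\<in>X. c' x * v x e') = 0"
        using c(2) by (simp add: sum)
      moreover have "\<exists>x\<in>X. c' x \<noteq> 0" using c(1) X' by (auto simp: c'_def)
      ultimately show ?thesis by blast
    qed
  qed
  then show thesis using that by blast
qed

definition box_exponents :: "nat set \<Rightarrow> nat \<Rightarrow> (nat \<Rightarrow>\<^sub>0 nat) set" where
  "box_exponents V b = {m. Poly_Mapping.keys m \<subseteq> V \<and> (\<forall>x. Poly_Mapping.lookup m x \<le> b)}"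

lemma box_exponents_card:
  assumes "finite V"
  shows "finite (box_exponents V b)" "card (box_exponents V b) \<le> (b + 1) ^ card V"
proof -
  let ?r = "\<lambda>m. restrict (Poly_Mapping.lookup m) V"
  have inj: "inj_on ?r (box_exponents V b)"
  proof (rule inj_onI)
    fix m m' assume *: "m \<in> box_exponents V b" "m' \<in> box_exponents V b" "?r m = ?r m'"
    have "Poly_Mapping.lookup m x = Poly_Mapping.lookup m' x" for x
    proof (cases "x \<in> V")
      case True
      then show ?thesis using fun_cong[OF *(3), of x] by simp
    next
      case False
      then have "x \<notin> Poly_Mapping.keys m" "x \<notin> Poly_Mapping.keys m'"
        using * by (auto simp: box_exponents_def)
      then show ?thesis by (simp add: in_keys_iff)
    qed
    then show "m = m'" by (rule poly_mapping_eqI)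
  qed
  have sub: "?r ` box_exponents V b \<subseteq> PiE V (\<lambda>_. {..b})"
    by (auto simp: box_exponents_def)
  have fin: "finite (PiE V (\<lambda>_. {..b}))" using assms by (intro finite_PiE) auto
  show "finite (box_exponents V b)"
    using finite_imageD[OF finite_subset[OF sub fin] inj] .
  show "card (box_exponents V b) \<le> (b + 1) ^ card V"
    using card_mono[OF fin sub] by (simp add: card_image[OF inj] card_PiE[OF assms])
qed

lemma box_exponents_add:
  "a \<in> box_exponents V b \<Longrightarrow> a' \<in> box_exponents V b' \<Longrightarrow> a + a' \<in> box_exponents V (b + b')"
  by (auto simp: box_exponents_def keys_exp_add lookup_add intro: add_mono)

fun power_prod :: "'a::comm_ring_1 list \<Rightarrow> nat list \<Rightarrow> 'a" where
  "power_prod (r # rs) (j # js) = r ^ j * power_prod rs js"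
| "power_prod _ _ = 1"

text \<open>
  The exponent vectors of the products of powers that enter an algebraic relation.
\<close>

definition grid :: "nat \<Rightarrow> nat \<Rightarrow> nat list set" where
  "grid N k = {js. set js \<subseteq> {..<N} \<and> length js = k}"

lemma grid_0: "grid N 0 = {[]}"
  by (auto simp: grid_def)

lemma finite_grid: "finite (grid N k)" and card_grid: "card (grid N k) = N ^ k"
  using finite_lists_length_eq[of "{..<N}" k] card_lists_length_eq[of "{..<N}" k]
  by (simp_all add: grid_def)

lemma sum_grid_Suc: "(\<Sum>js\<in>grid N (Suc k). f js) = (\<Sum>j<N. \<Sum>js\<in>grid N k. f (j # js))"
proof -
  have "grid N (Suc k) = (\<lambda>(j, js). j # js) ` ({..<N} \<times> grid N k)"
    by (auto simp: grid_def length_Suc_conv image_iff)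
  moreover have "inj_on (\<lambda>(j, js). j # js) ({..<N} \<times> grid N k)"
    by (auto simp: inj_on_def)
  ultimately show ?thesis
    by (simp add: sum.reindex sum.cartesian_product case_prod_unfold)
qed

abbreviation const_poly :: "'k::comm_ring_1 \<Rightarrow> 'k mpoly" where
  "const_poly c \<equiv> Poly_Mapping.single 0 c"

lemma power_prod_box:
  assumes "set rs \<subseteq> monomial_span (box_exponents V b)" "js \<in> grid N (length rs)"
  shows "power_prod rs js \<in> monomial_span (box_exponents V (length rs * (b * N)))"
  using assms
proof (induction rs js rule: power_prod.induct)
  case (1 r rs j js)
  have pow: "r ^ i \<in> monomial_span (box_exponents V (b * i))" for i
  proof (induction i)
    case 0
    show ?case by (auto simp: monomial_span_def box_exponents_def)
  next
    case (Suc i)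
    have "r * r ^ i \<in> monomial_span (box_exponents V (b + b * i))"
      using 1 Suc by (intro monomial_span_mult[OF _ Suc box_exponents_add]) auto
    then show ?case by simp
  qed
  have "j < N" using 1 by (auto simp: grid_def)
  then have "box_exponents V (b * j) \<subseteq> box_exponents V (b * N)"
    by (auto simp: box_exponents_def intro: order_trans[of _ "b * j"])
  then have "r ^ j \<in> monomial_span (box_exponents V (b * N))"
    using pow monomial_span_mono by blast
  moreover have "power_prod rs js \<in> monomial_span (box_exponents V (length rs * (b * N)))"
    using 1 by (intro 1) (auto simp: grid_def)
  ultimately have "r ^ j * power_prod rs js
      \<in> monomial_span (box_exponents V (b * N + length rs * (b * N)))"
    by (rule monomial_span_mult) (rule box_exponents_add)
  then show ?case by simp
qed (auto simp: monomial_span_def box_exponents_def)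

lemma finite_box_bound:
  assumes "finite Q" "Q \<subseteq> monomial_span {m. Poly_Mapping.keys m \<subseteq> V}"
  obtains b where "Q \<subseteq> (monomial_span (box_exponents V b) :: ('k::comm_ring_1) mpoly set)"
proof -
  have "\<exists>b. Q \<subseteq> (monomial_span (box_exponents V b) :: 'k mpoly set)"
  proof
    let ?B = "\<Union>q\<in>Q. \<Union>m\<in>Poly_Mapping.keys q. Poly_Mapping.lookup m ` Poly_Mapping.keys m"
    have fin: "finite (insert 0 ?B)" using assms(1) by auto
    show "Q \<subseteq> monomial_span (box_exponents V (Max (insert 0 ?B)))"
    proof
      fix q assume q: "q \<in> Q"
      have "m \<in> box_exponents V (Max (insert 0 ?B))" if m: "m \<in> Poly_Mapping.keys q" for m
      proof -
        have "Poly_Mapping.lookup m x \<le> Max (insert 0 ?B)" for x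
        proof (cases "x \<in> Poly_Mapping.keys m")
          case True
          then show ?thesis by (intro Max_ge[OF fin]) (use q m in blast)
        next
          case False
          then show ?thesis by (simp add: in_keys_iff)
        qed
        then show ?thesis using assms(2) q m by (auto simp: box_exponents_def monomial_span_def)
      qed
      then show "q \<in> monomial_span (box_exponents V (Max (insert 0 ?B)))"
        by (auto simp: monomial_span_def)
    qed
  qed
  then show thesis using that by blast
qed

text \<open>
  The products \<open>r\<^sub>1\<^bsup>j\<^sub>1\<^esup> \<cdots> r\<^sub>k\<^bsup>j\<^sub>k\<^esup>\<close> with all exponents below \<open>N\<close> are \<open>N ^ k\<close> in number, but they lie in a
  vector space whose dimension grows like \<open>N ^ card V\<close>, since the exponents of the variables in such a
  product are bounded linearly in \<open>N\<close>.
\<close>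

lemma algebraically_dependent:
  fixes rs :: "('k::field) mpoly list"
  assumes V: "finite V" and rs: "set rs \<subseteq> monomial_span {m. Poly_Mapping.keys m \<subseteq> V}"
    and len: "card V < length rs"
  obtains N c where "\<exists>js\<in>grid N (length rs). c js \<noteq> 0"
    and "(\<Sum>js\<in>grid N (length rs). const_poly (c js) * power_prod rs js) = 0"
proof -
  let ?d = "card V" and ?k = "length rs"
  obtain b where b: "set rs \<subseteq> monomial_span (box_exponents V b)"
    using finite_box_bound[OF _ rs] by auto
  \<comment> \<open>The space of the products has dimension at most \<open>(C * N) ^ ?d\<close>,
      and \<open>N > C ^ ?d\<close> makes this less than \<open>N ^ Suc ?d\<close>.\<close>
  define C where "C = ?k * b + 1"
  define N where "N = C ^ ?d + 1"
  have N: "C ^ ?d < N" "1 \<le> N" by (simp_all add: N_def)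
  let ?E = "box_exponents V (?k * (b * N))"
  have "card ?E \<le> (?k * (b * N) + 1) ^ ?d" by (rule box_exponents_card(2)[OF V])
  also have "\<dots> \<le> (C * N) ^ ?d"
  proof (rule power_mono)
    show "?k * (b * N) + 1 \<le> C * N" using N(2) by (simp add: C_def distrib_right)
  qed simp
  also have "\<dots> = C ^ ?d * N ^ ?d" by (rule power_mult_distrib)
  also have "\<dots> < N * N ^ ?d" using N by (intro mult_strict_right_mono) simp_all
  also have "\<dots> = N ^ Suc ?d" by simp
  also have "\<dots> \<le> N ^ ?k" using len by (intro power_increasing N(2)) simp
  finally have "card ?E < card (grid N ?k)" by (simp add: card_grid)
  then obtain c where c: "\<exists>js\<in>grid N ?k. c js \<noteq> 0"
    and zero: "\<And>e. e \<in> ?E \<Longrightarrow> (\<Sum>js\<in>grid N ?k. c js * Poly_Mapping.lookup (power_prod rs js) e) = 0"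
    by (rule homogeneous_system_nontrivial[OF box_exponents_card(1)[OF V] finite_grid,
          where v = "\<lambda>js. Poly_Mapping.lookup (power_prod rs js)"]) (rule that, assumption, blast)
  have lk: "Poly_Mapping.lookup (const_poly (c js) * power_prod rs js) e =
      c js * Poly_Mapping.lookup (power_prod rs js) e" for js e
    using lookup_single_mult[of 0 "c js" "power_prod rs js" e] by simp
  have "(\<Sum>js\<in>grid N ?k. const_poly (c js) * power_prod rs js) = 0"
  proof (rule poly_mapping_eqI)
    fix e
    have "(\<Sum>js\<in>grid N ?k. c js * Poly_Mapping.lookup (power_prod rs js) e) = 0"
    proof (cases "e \<in> ?E")
      case False
      have "Poly_Mapping.lookup (power_prod rs js) e = 0" if "js \<in> grid N ?k" for js
        using power_prod_box[OF b that] False by (auto simp: monomial_span_def in_keys_iff)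
      then show ?thesis by simp
    qed (rule zero)
    then show "Poly_Mapping.lookup (\<Sum>js\<in>grid N ?k. const_poly (c js) * power_prod rs js) e =
        Poly_Mapping.lookup 0 e"
      by (simp add: lookup_sum lk)
  qed
  with c show thesis by (rule that)
qed

section \<open>Chains of primes and the Krull dimension\<close>

lemma primeideal_mpolyD:
  fixes Q :: "('k::comm_ring_1) mpoly set"
  assumes "primeideal Q (mpoly_ring n)"
  shows "Q \<subseteq> monomial_span (exponents n)" "1 \<notin> Q"
    and "\<And>p q. p \<in> Q \<Longrightarrow> q \<in> Q \<Longrightarrow> p - q \<in> Q"
    and "\<And>p q. p \<in> Q \<Longrightarrow> q \<in> Q \<Longrightarrow> p + q \<in> Q"
    and "\<And>p q. p \<in> monomial_span (exponents n) \<Longrightarrow> q \<in> Q \<Longrightarrow> p * q \<in> Q"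
    and "\<And>p q. p \<in> monomial_span (exponents n) \<Longrightarrow> q \<in> monomial_span (exponents n) \<Longrightarrow>
           p * q \<in> Q \<Longrightarrow> p \<in> Q \<or> q \<in> Q"
proof -
  interpret primeideal Q "mpoly_ring n" by fact
  show "Q \<subseteq> monomial_span (exponents n)" using a_subset by simp
  show "1 \<notin> Q" using one_imp_carrier I_notcarr by auto
  show mult: "p * q \<in> Q" if "p \<in> monomial_span (exponents n)" "q \<in> Q" for p q
    using I_l_closed[of q p] that by simp
  show add: "p + q \<in> Q" if "p \<in> Q" "q \<in> Q" for p q
    using additive_subgroup.a_closed[OF additive_subgroup_axioms, of p q] that by simp
  show "p - q \<in> Q" if "p \<in> Q" "q \<in> Q" for p q
  proof -
    have "- 1 \<in> (monomial_span (exponents n) :: 'k mpoly set)"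
      by (intro monomial_span_uminus) (simp add: monomial_span_def exponents_def)
    then have "- 1 * q \<in> Q" using that(2) by (rule mult)
    then show ?thesis using add[OF that(1), of "- 1 * q"] by simp
  qed
  show "p \<in> Q \<or> q \<in> Q"
    if "p \<in> monomial_span (exponents n)" "q \<in> monomial_span (exponents n)" "p * q \<in> Q" for p q
    using I_prime[of p q] that by simp
qed

lemma mult_mpoly_closed:
  "p \<in> monomial_span (exponents n) \<Longrightarrow> q \<in> monomial_span (exponents n) \<Longrightarrow>
     p * q \<in> monomial_span (exponents n)"
  by (rule monomial_span_mult) (auto intro: add_exponents)

lemma one_mpoly_closed: "1 \<in> monomial_span (exponents n)"
  by (simp add: monomial_span_def exponents_def)

lemma const_poly_closed: "const_poly c \<in> monomial_span (exponents n)"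
  by (simp add: monomial_span_def exponents_def)

lemma power_mpoly_closed:
  "p \<in> monomial_span (exponents n) \<Longrightarrow> p ^ i \<in> monomial_span (exponents n)"
  by (induction i) (auto intro: mult_mpoly_closed one_mpoly_closed)

lemma power_prod_closed:
  "set rs \<subseteq> monomial_span (exponents n) \<Longrightarrow> power_prod rs js \<in> monomial_span (exponents n)"
  by (induction rs js rule: power_prod.induct)
     (auto intro: mult_mpoly_closed one_mpoly_closed power_mpoly_closed)

text \<open>
  Elements \<open>r\<^sub>i \<in> Q\<^sub>i - Q\<^sub>i\<^sub>-\<^sub>1\<close> along a chain of primes satisfy no algebraic relation modulo \<open>Q\<^sub>0\<close>.  Order
  a relation by powers of \<open>r\<^sub>1\<close> and divide by the lowest power, which is not in the prime \<open>Q\<^sub>0\<close>.  What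
  remains is in \<open>Q\<^sub>0 \<subseteq> Q\<^sub>1\<close>, and modulo \<open>r\<^sub>1 \<in> Q\<^sub>1\<close> it is a nontrivial relation among \<open>r\<^sub>2, \<dots>, r\<^sub>k\<close>
  modulo \<open>Q\<^sub>1\<close>.
\<close>

lemma prime_chain_independent:
  fixes Q :: "nat \<Rightarrow> ('k::field) mpoly set"
  assumes "\<And>i. i \<le> length rs \<Longrightarrow> primeideal (Q i) (mpoly_ring n)"
    and "\<And>i. i < length rs \<Longrightarrow> Q i \<subseteq> Q (Suc i)"
    and "\<And>i. i < length rs \<Longrightarrow> rs ! i \<in> Q (Suc i) - Q i"
    and "\<exists>js\<in>grid N (length rs). c js \<noteq> 0"
  shows "(\<Sum>js\<in>grid N (length rs). const_poly (c js) * power_prod rs js) \<notin> Q 0"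
  using assms
proof (induction rs arbitrary: Q c)
  case Nil
  note Q0 = primeideal_mpolyD[OF Nil(1)[of 0, simplified]]
  have c: "c [] \<noteq> 0" using Nil by (simp add: grid_0)
  have "const_poly (c []) \<notin> Q 0"
  proof
    assume "const_poly (c []) \<in> Q 0"
    then have "const_poly (inverse (c [])) * const_poly (c []) \<in> Q 0"
      using Q0(5) const_poly_closed by blast
    then show False using Q0(2) c by (simp add: mult_single)
  qed
  then show ?case by (simp add: grid_0)
next
  case (Cons r rs)
  let ?S = "monomial_span (exponents n) :: 'k mpoly set"
  let ?k = "length rs"
  have prime: "primeideal (Q i) (mpoly_ring n)" if "i \<le> Suc ?k" for i
    using Cons.prems(1)[of i] that by simp
  have "primeideal (Q 0) (mpoly_ring n)" "primeideal (Q 1) (mpoly_ring n)"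
    using prime by simp_all
  note Q0 = primeideal_mpolyD[OF this(1)] and Q1 = primeideal_mpolyD[OF this(2)]
  have Q01: "Q 0 \<subseteq> Q 1" using Cons.prems(2)[of 0] by simp
  have r: "r \<in> Q 1" "r \<notin> Q 0" using Cons.prems(3)[of 0] by auto
  have rS: "r \<in> ?S" using r Q1(1) by blast
  have rsS: "set rs \<subseteq> ?S"
  proof
    fix p assume "p \<in> set rs"
    then obtain i where i: "i < ?k" "p = rs ! i" by (auto simp: in_set_conv_nth)
    then have "p \<in> Q (Suc (Suc i))" using Cons.prems(3)[of "Suc i"] by simp
    then show "p \<in> ?S" using primeideal_mpolyD(1)[OF prime[of "Suc (Suc i)"]] i by auto
  qed
  define G where "G j = (\<Sum>js\<in>grid N ?k. const_poly (c (j # js)) * power_prod rs js)" for j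
  have GS: "G j \<in> ?S" for j
    unfolding G_def
    by (intro monomial_span_sum mult_mpoly_closed const_poly_closed power_prod_closed rsS)
  have ex: "\<exists>j. j < N \<and> (\<exists>js\<in>grid N ?k. c (j # js) \<noteq> 0)"
    using Cons.prems(4) by (auto simp: grid_def length_Suc_conv) blast
  define j0 where "j0 = (LEAST j. j < N \<and> (\<exists>js\<in>grid N ?k. c (j # js) \<noteq> 0))"
  have j0: "j0 < N" "\<exists>js\<in>grid N ?k. c (j0 # js) \<noteq> 0"
    using LeastI_ex[OF ex] by (simp_all add: j0_def)
  have G0: "G j = 0" if "j < j0" for j
  proof -
    have "c (j # js) = 0" if "js \<in> grid N ?k" for js
      using not_less_Least[of j] \<open>j < j0\<close> j0(1) that unfolding j0_def[symmetric] 
      by (metis (mono_tags, lifting) j0_def less_trans)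
    then show ?thesis by (simp add: G_def)
  qed
  define X where "X = (\<Sum>j\<in>{Suc j0..<N}. r ^ (j - Suc j0) * G j)"
  have XS: "X \<in> ?S"
    unfolding X_def by (intro monomial_span_sum mult_mpoly_closed power_mpoly_closed rS GS)
  have "(\<Sum>js\<in>grid N (length (r # rs)). const_poly (c js) * power_prod (r # rs) js) =
      (\<Sum>j<N. r ^ j * G j)"
    by (simp add: sum_grid_Suc G_def sum_distrib_left mult.left_commute)
  also have "\<dots> = (\<Sum>j\<in>{j0..<N}. r ^ j * G j)"
    by (rule sum.mono_neutral_right) (auto simp: G0)
  also have "\<dots> = r ^ j0 * G j0 + (\<Sum>j\<in>{Suc j0..<N}. r ^ j * G j)"
    using j0(1) by (rule sum.atLeast_Suc_lessThan)
  also have "(\<Sum>j\<in>{Suc j0..<N}. r ^ j * G j) = r ^ j0 * (r * X)"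
  proof -
    have "r ^ j = r ^ j0 * (r * r ^ (j - Suc j0))" if "Suc j0 \<le> j" for j
      using that by (simp flip: power_Suc power_add)
    then show ?thesis
      by (simp add: X_def sum_distrib_left mult.assoc)
  qed
  finally have eq: "(\<Sum>js\<in>grid N (length (r # rs)). const_poly (c js) * power_prod (r # rs) js) =
      r ^ j0 * (G j0 + r * X)"
    by (simp add: distrib_left)
  have pow: "r ^ i \<notin> Q 0" for i
  proof (induction i)
    case (Suc i)
    then show ?case using Q0(6)[OF rS power_mpoly_closed[OF rS]] r(2) by auto
  qed (simp add: Q0(2))
  have "G j0 \<notin> Q 1"
  proof -
    have "(\<Sum>js\<in>grid N ?k. const_poly (c (j0 # js)) * power_prod rs js) \<notin> (Q \<circ> Suc) 0"
    proof (rule Cons.IH)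
      fix i assume "i < ?k"
      then show "(Q \<circ> Suc) i \<subseteq> (Q \<circ> Suc) (Suc i)" "rs ! i \<in> (Q \<circ> Suc) (Suc i) - (Q \<circ> Suc) i"
        using Cons.prems(2,3)[of "Suc i"] by auto
    qed (use prime j0(2) in auto)
    then show ?thesis by (simp add: G_def)
  qed
  moreover have "r * X \<in> Q 1" using Q1(5)[OF XS r(1)] by (simp add: mult.commute)
  ultimately have "G j0 + r * X \<notin> Q 0"
    using Q01 Q1(3)[of "G j0 + r * X" "r * X"] by auto
  moreover have "G j0 + r * X \<in> ?S"
    by (intro monomial_span_add GS mult_mpoly_closed rS XS)
  ultimately show ?case
    unfolding eq using Q0(6)[OF power_mpoly_closed[OF rS]] pow by blast
qed

text \<open>
  Modulo the ideal, a polynomial is represented by its part in the monomials without variables of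
  \<open>B\<close>.  These monomials are closed under products, and the polynomial ring has no zero divisors.
\<close>

lemma primeideal_meeting:
  "primeideal (monomial_span (meeting_exponents n B) :: ('k::field) mpoly set) (mpoly_ring n)"
proof (rule primeidealI)
  let ?P = "monomial_span (meeting_exponents n B) :: 'k mpoly set"
  have "0 \<notin> meeting_exponents n B" by (simp add: meeting_exponents_def)
  then have "1 \<notin> ?P" by (simp add: monomial_span_def)
  then show "carrier (mpoly_ring n) \<noteq> ?P" using one_mpoly_closed by auto
  have cover: "exponents n = meeting_exponents n B \<union> exponents n"
    by (auto simp: meeting_exponents_def)
  let ?V = "exponents n - meeting_exponents n B"
  have V_add: "a + b \<in> ?V" if "a \<in> ?V" "b \<in> ?V" for a b
    using that by (auto simp: exponents_def meeting_exponents_def keys_exp_add)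
  have abs: "a * b \<in> ?P" if "a \<in> ?P" "b \<in> monomial_span (exponents n)" for a b
    using that(2,1) by (subst mult.commute) (rule monomial_span_mult, auto intro: meeting_exponents_add)
  fix p q :: "'k mpoly"
  assume p: "p \<in> carrier (mpoly_ring n)" and q: "q \<in> carrier (mpoly_ring n)"
    and pq: "p \<otimes>\<^bsub>mpoly_ring n\<^esub> q \<in> ?P"
  from p cover have "p \<in> monomial_span (meeting_exponents n B \<union> exponents n)" by simp
  then obtain p1 p0 where p': "p = p1 + p0" "p1 \<in> ?P" "p0 \<in> monomial_span ?V"
    by (rule monomial_span_Un_split)
  from q cover have "q \<in> monomial_span (meeting_exponents n B \<union> exponents n)" by simp
  then obtain q1 q0 where q': "q = q1 + q0" "q1 \<in> ?P" "q0 \<in> monomial_span ?V"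
    by (rule monomial_span_Un_split)
  have p0: "p0 \<in> monomial_span (exponents n)" and q0: "q0 \<in> monomial_span (exponents n)"
    using p'(3) q'(3) by (auto simp: monomial_span_def)
  have "p1 * q \<in> ?P" "q1 * p0 \<in> ?P" using abs p' q' q p0 by auto
  then have "p * q - p1 * q - q1 * p0 \<in> ?P" using pq by (intro monomial_span_diff) simp_all
  also have "p * q - p1 * q - q1 * p0 = p0 * q0" by (simp add: p' q' algebra_simps)
  finally have "p0 * q0 \<in> ?P" .
  moreover have "p0 * q0 \<in> monomial_span ?V"
    using p'(3) q'(3) V_add by (rule monomial_span_mult)
  ultimately have "Poly_Mapping.keys (p0 * q0) = {}" unfolding monomial_span_def by blast
  then have "p0 = 0 \<or> q0 = 0" by simp
  then show "p \<in> ?P \<or> q \<in> ?P" using p' q' by auto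
qed (rule ideal_meeting cring_mpoly_ring)+

lemma (in cring) quotient_image_mem_iff:
  assumes "ideal J R" "ideal P R" "J \<subseteq> P" "a \<in> carrier R"
  shows "J +> a \<in> (+>) J ` P \<longleftrightarrow> a \<in> P"
proof -
  have sub: "(+>) J ` P \<subseteq> carrier (R Quot J)"
    using additive_subgroup.a_subset[OF ideal.axioms(1)[OF ring_ideal_imp_quot_ideal[OF assms(1,2)]]] .
  have "J +> a \<in> (+>) J ` P \<longleftrightarrow> a \<in> \<Union> ((+>) J ` P)"
    by (rule canonical_proj_vimage_mem_iff[OF assms(1) sub assms(4), symmetric])
  also have "\<Union> ((+>) J ` P) = P"
    using iffD1[OF ideal_incl_iff[OF assms(1,2)] assms(3)] by (rule sym)
  finally show ?thesis .
qed

lemma (in cring) quotient_image_primeideal: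
  assumes J: "ideal J R" and P: "primeideal P R" and "J \<subseteq> P"
  shows "primeideal ((+>) J ` P) (R Quot J)"
proof (rule primeidealI)
  interpret P: primeideal P R by fact
  note iff = quotient_image_mem_iff[OF J P.is_ideal \<open>J \<subseteq> P\<close>]
  have hom: "(+>) J \<in> ring_hom R (R Quot J)" using J by (rule ideal.rcos_ring_hom)
  have carrier: "carrier (R Quot J) = (+>) J ` carrier R"
    by (auto simp: FactRing_def A_RCOSETS_def')
  show "ideal ((+>) J ` P) (R Quot J)"
    using J P.is_ideal by (rule ring_ideal_imp_quot_ideal)
  show "cring (R Quot J)" using ideal.quotient_is_cring[OF J is_cring] .
  show "carrier (R Quot J) \<noteq> (+>) J ` P"
  proof
    assume eq: "carrier (R Quot J) = (+>) J ` P"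
    have "a \<in> P" if "a \<in> carrier R" for a
      using iff[OF that] imageI[OF that, of "(+>) J"] eq carrier by simp
    then show False using P.I_notcarr P.a_subset by blast
  qed
  fix x y assume "x \<in> carrier (R Quot J)" "y \<in> carrier (R Quot J)"
    and xy: "x \<otimes>\<^bsub>R Quot J\<^esub> y \<in> (+>) J ` P"
  then obtain a b where ab: "a \<in> carrier R" "x = J +> a" "b \<in> carrier R" "y = J +> b"
    unfolding carrier by (elim imageE)
  then have "J +> (a \<otimes> b) \<in> (+>) J ` P" using xy ring_hom_mult[OF hom] by simp
  then have "a \<otimes> b \<in> P" using iff ab by simp
  then have "a \<in> P \<or> b \<in> P" using P.I_prime ab by simp
  then show "x \<in> (+>) J ` P \<or> y \<in> (+>) J ` P" unfolding ab by (auto intro: imageI)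
qed

text \<open>
  Adding the variables outside \<open>B\<close> to the ideal one at a time gives a chain of primes of the right
  length.  A longer chain would contain, in its successive differences, more polynomials in the
  variables outside \<open>B\<close> than there are such variables; these would be both algebraically dependent
  and algebraically independent.
\<close>

lemma krull_dim_quotient_monomial_prime:
  assumes B: "B \<subseteq> {1..n}"
  shows "krull_dim (mpoly_ring n Quot (monomial_span (meeting_exponents n B) :: ('k::field) mpoly set))
           = enat (n - card B)"
proof -
  let ?R = "mpoly_ring n :: 'k mpoly ring"
  let ?J = "monomial_span (meeting_exponents n B) :: 'k mpoly set"
  let ?S = "monomial_span (exponents n) :: 'k mpoly set"
  let ?V = "{1..n} - B"
  interpret cring ?R by (rule cring_mpoly_ring)
  interpret J: ideal ?J ?R by (rule ideal_meeting)
  have card_V: "card ?V = n - card B"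
    using B by (simp add: card_Diff_subset finite_subset[OF _ finite_atLeastAtMost])
  let ?chain = "\<lambda>k Q. (\<forall>i\<le>k. primeideal (Q i) (?R Quot ?J)) \<and> (\<forall>i<k. Q i \<subset> Q (Suc i))"
  have upper: "k \<le> card ?V" if chain: "?chain k Q" for k Q
  proof (rule ccontr)
    assume "\<not> k \<le> card ?V"
    define Q' where "Q' i = {p \<in> ?S. ?J +>\<^bsub>?R\<^esub> p \<in> Q i}" for i
    have prime: "primeideal (Q' i) ?R" if "i \<le> k" for i
      using ring_hom_ring.primeideal_vimage[OF J.rcos_ring_hom_ring cring_mpoly_ring, of "Q i"]
        chain that by (simp add: Q'_def)
    have J_sub: "?J \<subseteq> Q' i" if "i \<le> k" for i
    proof
      fix p assume p: "p \<in> ?J"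
      interpret Qi: primeideal "Q i" "?R Quot ?J" using chain that by blast
      have "?J +>\<^bsub>?R\<^esub> p = ?J" using p by (rule J.a_rcos_const)
      moreover have "?J \<in> Q i" using additive_subgroup.zero_closed[OF Qi.additive_subgroup_axioms] by (simp add: FactRing_def)
      ultimately show "p \<in> Q' i" using p J.a_subset by (auto simp: Q'_def)
    qed
    have step: "\<exists>r. r \<in> monomial_span {m. Poly_Mapping.keys m \<subseteq> ?V} \<and> r \<in> Q' (Suc i) - Q' i"
      if i: "i < k" for i
    proof -
      interpret Qi: primeideal "Q (Suc i)" "?R Quot ?J" using chain i by auto
      obtain x where x: "x \<in> Q (Suc i)" "x \<notin> Q i" using chain i by blast
      then have "x \<in> carrier (?R Quot ?J)" using Qi.a_subset by blast
      then obtain p where p: "p \<in> ?S" "x = ?J +>\<^bsub>?R\<^esub> p"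
        by (auto simp: FactRing_def A_RCOSETS_def')
      then have pQ: "p \<in> Q' (Suc i)" "p \<notin> Q' i" using x by (auto simp: Q'_def)
      have "exponents n = meeting_exponents n B \<union> exponents n"
        by (auto simp: meeting_exponents_def)
      with p have "p \<in> monomial_span (meeting_exponents n B \<union> exponents n)" by simp
      then obtain q r where qr: "p = q + r" "q \<in> ?J"
        and r: "r \<in> monomial_span (exponents n - meeting_exponents n B)"
        by (rule monomial_span_Un_split)
      have "r \<in> Q' (Suc i)"
        using primeideal_mpolyD(3)[OF prime[of "Suc i"] pQ(1), of q] J_sub[of "Suc i"] qr i by auto
      moreover have "r \<notin> Q' i"
        using primeideal_mpolyD(4)[OF prime[of i], of q r] J_sub[of i] qr i pQ(2) by auto
      moreover have "exponents n - meeting_exponents n B \<subseteq> {m. Poly_Mapping.keys m \<subseteq> ?V}"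
        by (auto simp: exponents_def meeting_exponents_def)
      then have "r \<in> monomial_span {m. Poly_Mapping.keys m \<subseteq> ?V}"
        using r monomial_span_mono[of "exponents n - meeting_exponents n B"] by blast
      ultimately show ?thesis by blast
    qed
    then obtain r where r: "\<And>i. i < k \<Longrightarrow> r i \<in> monomial_span {m. Poly_Mapping.keys m \<subseteq> ?V}"
      "\<And>i. i < k \<Longrightarrow> r i \<in> Q' (Suc i) - Q' i"
      by metis
    define rs where "rs = map r [0..<k]"
    have rs: "length rs = k" "\<And>i. i < k \<Longrightarrow> rs ! i = r i" by (simp_all add: rs_def)
    have rs_V: "set rs \<subseteq> monomial_span {m. Poly_Mapping.keys m \<subseteq> ?V}"
      using r(1) by (auto simp: rs_def)
    have "card ?V < length rs" using \<open>\<not> k \<le> card ?V\<close> rs(1) by simp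
    then obtain N c where c: "\<exists>js\<in>grid N (length rs). c js \<noteq> 0"
      and zero: "(\<Sum>js\<in>grid N (length rs). const_poly (c js) * power_prod rs js) = 0"
      by (rule algebraically_dependent[OF _ rs_V, rotated]) simp_all
    have "(\<Sum>js\<in>grid N (length rs). const_poly (c js) * power_prod rs js) \<notin> Q' 0"
    proof (rule prime_chain_independent[OF _ _ _ c])
      show "Q' i \<subseteq> Q' (Suc i)" if "i < length rs" for i
        using chain that rs(1) by (auto simp: Q'_def)
    qed (use prime r(2) rs in auto)
    moreover have "0 \<in> Q' 0"
      using J_sub[of 0] monomial_span_0 by blast
    ultimately show False using zero by simp
  qed
  have lower: "\<exists>Q. ?chain (card ?V) Q"
  proof -
    define vs where "vs = sorted_list_of_set ?V"
    have vs: "set vs = ?V" "distinct vs" "length vs = card ?V"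
      by (simp_all add: vs_def)
    define W where "W i = B \<union> set (take i vs)" for i
    define P where "P i = (monomial_span (meeting_exponents n (W i)) :: 'k mpoly set)" for i
    have P_prime: "primeideal (P i) ?R" for i
      unfolding P_def by (rule primeideal_meeting)
    have J_P: "?J \<subseteq> P i" for i
      unfolding P_def by (intro monomial_span_mono) (auto simp: meeting_exponents_def W_def)
    have strict: "(+>\<^bsub>?R\<^esub>) ?J ` P i \<subset> (+>\<^bsub>?R\<^esub>) ?J ` P (Suc i)" if i: "i < card ?V" for i
    proof -
      have "W i \<subseteq> W (Suc i)" using set_take_subset_set_take[of i "Suc i" vs] by (auto simp: W_def)
      then have sub: "P i \<subseteq> P (Suc i)"
        unfolding P_def by (intro monomial_span_mono) (auto simp: meeting_exponents_def)
      let ?v = "vs ! i"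
      have v: "?v \<in> ?V" using vs i nth_mem by metis
      have "?v \<in> W (Suc i)" using i vs(3) by (auto simp: W_def take_Suc_conv_app_nth)
      moreover have "?v \<notin> W i"
        using v i vs(2,3) by (auto simp: W_def in_set_conv_nth nth_eq_iff_index_eq)
      ultimately have "mvar ?v \<in> P (Suc i)" "mvar ?v \<notin> P i"
        using v by (auto simp: P_def mvar_def monomial_span_def meeting_exponents_def exponents_def)
      moreover have "mvar ?v \<in> carrier ?R" using v by (intro mvar_closed) blast
      ultimately have "?J +>\<^bsub>?R\<^esub> mvar ?v \<notin> (+>\<^bsub>?R\<^esub>) ?J ` P i"
        using quotient_image_mem_iff[OF J.is_ideal primeideal.axioms(1)[OF P_prime] J_P, of "mvar ?v" i]
        by simp
      moreover have "?J +>\<^bsub>?R\<^esub> mvar ?v \<in> (+>\<^bsub>?R\<^esub>) ?J ` P (Suc i)"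
        using \<open>mvar ?v \<in> P (Suc i)\<close> by (rule imageI)
      ultimately show ?thesis using image_mono[OF sub] by (metis psubsetI)
    qed
    then have "?chain (card ?V) (\<lambda>i. (+>\<^bsub>?R\<^esub>) ?J ` P i)"
      using quotient_image_primeideal[OF J.is_ideal P_prime J_P] by simp
    then show ?thesis by (intro exI[of _ "\<lambda>i. (+>\<^bsub>?R\<^esub>) ?J ` P i"])
  qed
  have "krull_dim (?R Quot ?J) = enat (card ?V)"
    unfolding krull_dim_def
  proof (rule antisym)
    show "Sup {enat k | k. \<exists>Q. ?chain k Q} \<le> enat (card ?V)"
      using upper by (intro Sup_least) auto
    show "enat (card ?V) \<le> Sup {enat k | k. \<exists>Q. ?chain k Q}"
      using lower by (intro Sup_upper) blast
  qed
  then show ?thesis by (simp only: card_V)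
qed

section \<open>Depth and dimension\<close>

theorem theorem2p3:
  fixes n s :: nat
    and P :: "nat \<Rightarrow> ('k::field) mpoly set"
    and I :: "'k mpoly set"
  assumes "\<And>i. i \<in> {1..s} \<Longrightarrow> monomial_prime_ideal n (P i)"
    and "I = ideal_inter (mpoly_ring n) P {1..s}"
    and "irredundant (mpoly_ring n) P {1..s}"
    and "\<And>i. i \<in> {1..s} \<Longrightarrow> \<not> P i \<subseteq> ideal_sum (mpoly_ring n) P ({1..s} - {i})"
  shows "depth (mpoly_ring n) (graded_maximal_ideal n) (ideal_module (mpoly_ring n) I)
       = enat s + krull_dim (mpoly_ring n Quot ideal_sum (mpoly_ring n) P {1..s})"
proof -
  have "\<exists>A. \<forall>i\<in>{1..s}. A i \<subseteq> {1..n} \<and> P i = monomial_span (meeting_exponents n (A i))"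
    using assms(1) unfolding monomial_prime_ideal_def by (metis genideal_mvars)
  then obtain A where A: "\<And>i. i \<in> {1..s} \<Longrightarrow> A i \<subseteq> {1..n}"
    and P: "\<And>i. i \<in> {1..s} \<Longrightarrow> P i = monomial_span (meeting_exponents n (A i))"
    by blast
  have I: "I = monomial_span (transversal_exponents n A {1..s})"
    unfolding assms(2) ideal_inter_def
    using P by (auto simp: monomial_span_def transversal_exponents_def meeting_exponents_def subset_iff)
  have private_var: "\<not> A i \<subseteq> (\<Union>j\<in>{1..s} - {i}. A j)" if i: "i \<in> {1..s}" for i
  proof
    assume "A i \<subseteq> (\<Union>j\<in>{1..s} - {i}. A j)"
    then have "meeting_exponents n (A i) \<subseteq> meeting_exponents n (\<Union>j\<in>{1..s} - {i}. A j)"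
      by (auto simp: meeting_exponents_def)
    moreover have "ideal_sum (mpoly_ring n) P ({1..s} - {i}) =
        monomial_span (meeting_exponents n (\<Union>j\<in>{1..s} - {i}. A j))"
      using P by (intro ideal_sum_monomial_primes) simp_all
    ultimately have "P i \<subseteq> ideal_sum (mpoly_ring n) P ({1..s} - {i})"
      using P[OF i] monomial_span_mono by simp
    then show False using assms(4)[OF i] by blast
  qed
  have sum: "ideal_sum (mpoly_ring n) P {1..s} =
      monomial_span (meeting_exponents n (\<Union>i\<in>{1..s}. A i))"
    using P by (intro ideal_sum_monomial_primes) simp_all
  have "(\<Union>i\<in>{1..s}. A i) \<subseteq> {1..n}" using A by blast
  then have "krull_dim (mpoly_ring n Quot ideal_sum (mpoly_ring n) P {1..s}) =
      enat (n - card (\<Union>i\<in>{1..s}. A i))"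
    unfolding sum by (rule krull_dim_quotient_monomial_prime)
  moreover have "depth (mpoly_ring n) (graded_maximal_ideal n) (ideal_module (mpoly_ring n) I) =
      enat (card {1..s} + (n - card (\<Union>i\<in>{1..s}. A i)))"
    unfolding I using A private_var by (intro depth_intersection_monomial_primes) simp_all
  ultimately show ?thesis by simp
qed

end
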